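(* Let $d\ge 2$ be an integer, let $\mu>0$, let $\boldsymbol{x}_0\in\mathbb{R}^d$ be fixed, and let $t>0$. Let $\mathcal{R}(\{\boldsymbol{x}_0\},t)\subset\mathbb{R}^d$ be the forward reach set at time $t$ of the $d$-dimensional integrator $\dot{\boldsymbol{x}}=\boldsymbol{A}\boldsymbol{x}+\boldsymbol{b}u$, $u\in[-\mu,\mu]$, started from $\boldsymbol{x}(0)=\boldsymbol{x}_0$. Then its $d$-dimensional volume (Lebesgue measure) is $$\mathrm{vol}\left(\mathcal{R}(\{\boldsymbol{x}_0\},t)\right)=\frac{(2\mu)^{d}\,t^{d(d+1)/2}}{\prod_{k=1}^{d-1}k!}\;\lim_{n\to\infty}\frac{1}{n^{d(d+1)/2}}\sum_{0\le i_1<i_2<\cdots<i_d\le n}\;\prod_{1\le\alpha<\beta\le d}(i_\beta-i_\alpha),$$ where the sum runs over all integer $d$-tuples $(i_1,\dots,i_d)$ with $0\le i_1<\cdots<i_d\le n$.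
   Context: Integrator dynamics: $\boldsymbol{A}\in\mathbb{R}^{d\times d}$ is the matrix whose columns are $\boldsymbol{0},\boldsymbol{e}_1,\boldsymbol{e}_2,\dots,\boldsymbol{e}_{d-1}$ (the upper shift matrix), and $\boldsymbol{b}=\boldsymbol{e}_d$, where $\boldsymbol{e}_i$ is the $i$-th standard basis column vector of $\mathbb{R}^d$. Forward reach set: for an initial set $\mathcal{X}_0\subset\mathbb{R}^d$ and $t>0$, $\mathcal{R}(\mathcal{X}_0,t)$ is the set of all points $\boldsymbol{x}(t)\in\mathbb{R}^d$, where $\boldsymbol{x}(\cdot)$ solves $\dot{\boldsymbol{x}}=\boldsymbol{A}\boldsymbol{x}+\boldsymbol{b}u$ on $[0,t]$ with $\boldsymbol{x}(0)\in\mathcal{X}_0$ for some (measurable) control $u:[0,t]\to[-\mu,\mu]$. Equivalently, $\mathcal{R}(\{\boldsymbol{x}_0\},t)=\{\exp(t\boldsymbol{A})\boldsymbol{x}_0+\int_0^t\exp((t-\tau)\boldsymbol{A})\boldsymbol{b}\,u(\tau)\,d\tau \;:\; u:[0,t]\to[-\mu,\mu]\ \text{measurable}\}$. *)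

theory Defs
  imports "HOL-Analysis.Analysis"
begin

text \<open>The coordinates of \<^typ>\<open>real ^ 'n\<close> are numbered \<open>1, \<dots>, d\<close>, where \<open>d = CARD('n)\<close>, in
  increasing order of the index type. A finite linear order is a wellorder, so the sort
  constraint only fixes this order; every \<open>d \<ge> 1\<close> is the cardinality of such a type.\<close>

definition coord_no :: "'n::{finite,wellorder} \<Rightarrow> nat" where
  "coord_no i = card {j. j \<le> i}"

text \<open>The standard basis vector \<open>e\<^sub>k\<close> for \<open>1 \<le> k \<le> d\<close>; it is the zero vector for \<open>k = 0\<close>.\<close>

definition std_basis :: "nat \<Rightarrow> real ^ 'n::{finite,wellorder}" where
  "std_basis k = (\<chi> i. if coord_no i = k then 1 else 0)"

text \<open>The matrix with columns \<open>0, e\<^sub>1, \<dots>, e\<^sub>d\<^sub>-\<^sub>1\<close>.\<close>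

definition integrator_A :: "real ^ 'n::{finite,wellorder} ^ 'n::_" where
  "integrator_A = (\<chi> i j. std_basis (coord_no j - 1) $ i)"

definition integrator_b :: "real ^ 'n::{finite,wellorder}" where
  "integrator_b = std_basis CARD('n)"

definition admissible_control :: "real \<Rightarrow> real \<Rightarrow> (real \<Rightarrow> real) \<Rightarrow> bool" where
  "admissible_control \<mu> t u \<longleftrightarrow>
     u \<in> borel_measurable (lebesgue_on {0..t}) \<and> (\<forall>\<tau>\<in>{0..t}. u \<tau> \<in> {-\<mu>..\<mu>})"

text \<open>For a merely measurable control, a solution of \<open>x' = A x + b u\<close> on \<open>[0,t]\<close> is understood
  in the sense of Caratheodory, that is, as a solution of the integral equation
  \<open>x s = x 0 + \<integral>\<^sub>0\<^sup>s (A (x \<tau>) + u \<tau> b) d\<tau>\<close> for all \<open>s\<close> in \<open>[0,t]\<close>. Such an \<open>x\<close> is continuous,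
  so for bounded \<open>u\<close> the Henstock-Kurzweil integral here is a Lebesgue integral.\<close>

definition integrator_solution ::
    "real \<Rightarrow> (real \<Rightarrow> real) \<Rightarrow> (real \<Rightarrow> real ^ 'n::{finite,wellorder}) \<Rightarrow> bool" where
  "integrator_solution t u x \<longleftrightarrow>
     (\<forall>s\<in>{0..t}. ((\<lambda>\<tau>. integrator_A *v x \<tau> + u \<tau> *\<^sub>R integrator_b) has_integral (x s - x 0)) {0..s})"

definition reach_set :: "real \<Rightarrow> (real ^ 'n::{finite,wellorder}) set \<Rightarrow> real \<Rightarrow> (real ^ 'n::_) set" where
  "reach_set \<mu> X0 t =
     {x t | x u. admissible_control \<mu> t u \<and> integrator_solution t u x \<and> x 0 \<in> X0}"

text \<open>The tuples \<open>(i\<^sub>1, \<dots>, i\<^sub>d)\<close> with \<open>0 \<le> i\<^sub>1 < \<dots> < i\<^sub>d \<le> n\<close>, as extensional functions.\<close>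

definition increasing_tuples :: "nat \<Rightarrow> nat \<Rightarrow> (nat \<Rightarrow> nat) set" where
  "increasing_tuples d n = {i \<in> {1..d} \<rightarrow>\<^sub>E {0..n}. strict_mono_on {1..d} i}"

definition vandermonde_sum :: "nat \<Rightarrow> nat \<Rightarrow> real" where
  "vandermonde_sum d n =
     (\<Sum>i\<in>increasing_tuples d n.
        \<Prod>(\<alpha>, \<beta>)\<in>{(\<alpha>, \<beta>). 1 \<le> \<alpha> \<and> \<alpha> < \<beta> \<and> \<beta> \<le> d}. (real (i \<beta>) - real (i \<alpha>)))"

end

theory Submission
  imports Defs
begin

text \<open>Up to a translation the reach set consists of the moment vectors
  \<open>\<integral>\<^sub>0\<^sup>t (t - x)\<^sup>e / e! u(x) dx\<close>, \<open>0 \<le> e < d\<close>, of the admissible controls \<open>u\<close>; it is a bounded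
  convex set. Its interior is parametrized by the bang-bang controls
  \<open>u\<^sub>s(x) = \<mu> sgn (\<Prod>\<^sub>l (x - s\<^sub>l))\<close> with exactly \<open>d\<close> switches \<open>0 < s\<^sub>1 < \<dots> < s\<^sub>d < t\<close>. The
  parametrization is injective because two monic polynomials of degree \<open>d\<close> differ by a
  polynomial of degree less than \<open>d\<close>; it is onto because its image is open by invariance of
  domain, while controls with fewer switches maximize a linear functional and so lie on the
  boundary. Its Jacobian matrix is a Vandermonde matrix up to scaling of rows and columns, so the
  change of variables formula expresses the volume as the integral of the Vandermonde product over
  the simplex of switching times, of which the sum in the theorem is a Riemann sum with mesh
  \<open>t / n\<close>, after scaling.\<close>

section \<open>Moments of the control\<close>

text \<open>By the symmetry u -> -u, the controls with \<open>d\<close> switches that end in -\<mu>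
  would parametrize the interior a second time; only those ending in +\<mu> are used. Polynomials
  enter because the \<open>d\<close> kernels span exactly the polynomials of degree less than
  \<open>d\<close>: a product of fewer than \<open>d\<close> factors x - s_l is a linear functional
  of the moments, the product of all \<open>d\<close> is not. Convexity serves twice: the interior
  is connected, so a nonempty clopen image fills it, and the frontier is a null set, so no boundary
  point has to be parametrized. The constants: each switch is a jump of size 2 \<mu>, whence (2
  \<mu>)^d; the kernels carry the factorials; the switches stay ordered, so no d! appears. The power
  of t collects d mesh widths from the cell volume and one from each of the d(d-1)/2 Vandermonde
  factors. To avoid cells cut by the boundary of the simplex, the Riemann sums run over a cube, with
  every Vandermonde factor truncated at 0: the integrand stays continuous and vanishes at unordered
  points.\<close>

text \<open>Difference quotients are at most \<open>C\<close> times the step, so the derivative is 0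
  everywhere.\<close>

lemma constant_on_if_quadratic_increments:
  fixes H :: "real \<Rightarrow> real"
  assumes "0 \<le> t" and H: "\<And>a b. 0 \<le> a \<Longrightarrow> a \<le> b \<Longrightarrow> b \<le> t \<Longrightarrow> \<bar>H b - H a\<bar> \<le> C * (b - a)\<^sup>2"
  shows "H t = H 0"
proof -
  have sym: "\<bar>H b - H a\<bar> \<le> C * \<bar>b - a\<bar>\<^sup>2" if "a \<in> {0..t}" "b \<in> {0..t}" for a b
    using H[of a b] H[of b a] that by (cases "a \<le> b") (auto simp: abs_minus_commute power2_commute)
  have "(H has_real_derivative 0) (at x within {0..t})" if x: "x \<in> {0..t}" for x
  proof -
    have "((\<lambda>y. (H y - H x) / (y - x)) \<longlongrightarrow> 0) (at x within {0..t})"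
    proof (rule Lim_null_comparison)
      show "\<forall>\<^sub>F y in at x within {0..t}. norm ((H y - H x) / (y - x)) \<le> C * \<bar>y - x\<bar>"
        unfolding eventually_at
        using sym[OF x] by (auto intro!: exI[of _ 1] simp: divide_simps power2_eq_square mult_ac)
      show "((\<lambda>y. C * \<bar>y - x\<bar>) \<longlongrightarrow> 0) (at x within {0..t})"
        by (rule tendsto_eq_intros refl | simp)+
    qed
    then show ?thesis
      by (simp add: has_field_derivative_iff)
  qed
  then have "\<exists>c. \<forall>x\<in>{0..t}. H x = c"
    by (intro has_field_derivative_zero_constant) auto
  then show ?thesis using \<open>0 \<le> t\<close> by force
qed

lemma integrable_on_bounded_measurable:
  fixes g :: "real \<Rightarrow> real"
  assumes "g \<in> borel_measurable (lebesgue_on {a..b})" "\<And>x. x \<in> {a..b} \<Longrightarrow> \<bar>g x\<bar> \<le> C"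
  shows "g integrable_on {a..b}"
  by (rule measurable_bounded_by_integrable_imp_integrable[OF assms(1), where g="\<lambda>_. C"])
     (use assms(2) in \<open>auto simp: integrable_const_ivl\<close>)

lemma borel_measurable_lebesgue_on_continuous:
  fixes f :: "real \<Rightarrow> real"
  assumes "continuous_on {a..b} f"
  shows "f \<in> borel_measurable (lebesgue_on {a..b})"
  by (rule continuous_imp_measurable_on_sets_lebesgue[OF assms]) auto

lemma integrable_on_continuous_times:
  fixes f g :: "real \<Rightarrow> real"
  assumes f: "continuous_on {a..b} f" and g: "g \<in> borel_measurable (lebesgue_on {a..b})"
    and C: "\<And>x. x \<in> {a..b} \<Longrightarrow> \<bar>g x\<bar> \<le> C"
  shows "(\<lambda>x. f x * g x) integrable_on {a..b}"
proof -
  have "compact (f ` {a..b})" by (intro compact_continuous_image f) auto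
  then obtain B where B: "\<And>x. x \<in> {a..b} \<Longrightarrow> \<bar>f x\<bar> \<le> B"
    by (metis bounded_iff compact_imp_bounded image_eqI real_norm_def)
  show ?thesis
  proof (rule integrable_on_bounded_measurable)
    show "(\<lambda>x. f x * g x) \<in> borel_measurable (lebesgue_on {a..b})"
      using borel_measurable_lebesgue_on_continuous[OF f] g by measurable
    show "\<bar>f x * g x\<bar> \<le> B * C" if "x \<in> {a..b}" for x
      using B[OF that] C[OF that] unfolding abs_mult by (intro mult_mono) auto
  qed
qed

text \<open>The primitive of a bounded measurable function need not be differentiable outside a
  countable set, so integration by parts is obtained by showing that the difference of
  both sides, as a function of the upper limit, has increments of second order.\<close>

lemma integral_by_parts_bounded_measurable:
  fixes f f' g :: "real \<Rightarrow> real"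
  assumes t: "0 \<le> t"
    and f: "\<And>x. x \<in> {0..t} \<Longrightarrow> (f has_real_derivative f' x) (at x within {0..t})"
    and f': "continuous_on {0..t} f'"
    and g: "g \<in> borel_measurable (lebesgue_on {0..t})"
    and C: "\<And>x. x \<in> {0..t} \<Longrightarrow> \<bar>g x\<bar> \<le> C"
  shows "integral {0..t} (\<lambda>x. f x * g x) =
    f t * integral {0..t} g - integral {0..t} (\<lambda>x. f' x * integral {0..x} g)"
proof -
  define G where "G s = integral {0..s} g" for s
  have C0: "C \<ge> 0" using C[of 0] t by auto
  have cf: "continuous_on {0..t} f"
    using f by (meson DERIV_continuous continuous_on_eq_continuous_within)
  have gi: "g integrable_on {0..t}"
    by (rule integrable_on_bounded_measurable[OF g C])
  have cG: "continuous_on {0..t} G"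
    unfolding G_def by (rule indefinite_integral_continuous_1[OF gi])
  have fgi: "(\<lambda>x. f x * g x) integrable_on {0..t}"
    by (rule integrable_on_continuous_times[OF cf g C])
  have f'Gi: "(\<lambda>x. f' x * G x) integrable_on {0..t}"
    by (intro integrable_continuous_interval continuous_intros f' cG)
  have "compact (f' ` {0..t})" by (intro compact_continuous_image f') auto
  then obtain L where L: "\<And>x. x \<in> {0..t} \<Longrightarrow> \<bar>f' x\<bar> \<le> L"
    by (metis bounded_iff compact_imp_bounded image_eqI real_norm_def)
  have L0: "L \<ge> 0" using L[of 0] t by auto
  \<comment> \<open>The defect of the formula with upper limit \<open>s\<close>. Since
    \<open>H 0 = 0\<close>, constancy of \<open>H\<close> is the claim.\<close>
  define H where "H s = integral {0..s} (\<lambda>x. f x * g x) - f s * G s + integral {0..s} (\<lambda>x. f' x * G x)" for s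
  have "\<bar>H b - H a\<bar> \<le> (2 * L * C) * (b - a)\<^sup>2" if ab: "0 \<le> a" "a \<le> b" "b \<le> t" for a b
  proof -
    have sub: "\<And>x. x \<in> {a..b} \<Longrightarrow> x \<in> {0..t}" "{a..b} \<subseteq> {0..t}" using ab by auto
    have split: "integral {0..b} h - integral {0..a} h = integral {a..b} h"
      if "h integrable_on {0..t}" for h :: "real \<Rightarrow> real"
      using Henstock_Kurzweil_Integration.integral_combine[of 0 a b h] ab
        integrable_on_subinterval[OF that, of 0 b] by auto
    have Gd: "G x - G a = integral {a..x} g" "\<bar>G x - G a\<bar> \<le> C * (b - a)" if x: "x \<in> {a..b}" for x
    proof -
      have gx: "g integrable_on {0..x}"
        using integrable_on_subinterval[OF gi, of 0 x] x ab by auto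
      show *: "G x - G a = integral {a..x} g"
        using Henstock_Kurzweil_Integration.integral_combine[of 0 a x g] ab x gx
        by (auto simp: G_def)
      have "norm (integral {a..x} g) \<le> C * (x - a)"
      proof (cases "a = x")
        case False
        have "(g has_integral integral {a..x} g) (cbox a x)"
          using integrable_on_subinterval[OF gi, of a x] x ab by auto
        from has_integral_bound[OF C0 this] C x ab show ?thesis by auto
      qed auto
      also have "\<dots> \<le> C * (b - a)" using x C0 by (intro mult_left_mono) auto
      finally show "\<bar>G x - G a\<bar> \<le> C * (b - a)" using * by auto
    qed
    have Lip: "\<bar>f x - f b\<bar> \<le> L * (b - a)" if x: "x \<in> {a..b}" for x
    proof -
      have "norm (f b - f x) \<le> L * norm (b - x)"
      proof (rule field_differentiable_bound[of "{0..t}" f f'])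
        show "norm (f' z) \<le> L" if "z \<in> {0..t}" for z using L[OF that] by simp
      qed (use f x ab in auto)
      also have "\<dots> \<le> L * (b - a)" using x L0 by (intro mult_left_mono) auto
      finally show ?thesis by (simp add: abs_minus_commute)
    qed
    have i1: "((\<lambda>x. f x * g x) has_integral integral {a..b} (\<lambda>x. f x * g x)) {a..b}"
      by (rule integrable_integral, rule integrable_on_subinterval[OF fgi sub(2)])
    have i2: "((\<lambda>x. f' x * G x) has_integral integral {a..b} (\<lambda>x. f' x * G x)) {a..b}"
      by (rule integrable_integral, rule integrable_on_subinterval[OF f'Gi sub(2)])
    have i3: "((\<lambda>x. f b * g x) has_integral f b * (G b - G a)) {a..b}"
      using Gd(1)[of b] ab integrable_on_subinterval[OF gi sub(2)]
      by (auto intro!: has_integral_mult_right)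
    have i4: "((\<lambda>x. f' x * G a) has_integral (f b - f a) * G a) {a..b}"
    proof (intro has_integral_mult_left fundamental_theorem_of_calculus)
      show "(f has_vector_derivative f' x) (at x within {a..b})" if "x \<in> {a..b}" for x
        using f[OF sub(1)[OF that]] sub(2)
        by (meson has_real_derivative_iff_has_vector_derivative DERIV_subset)
    qed (use ab in auto)
    have "((\<lambda>x. (f x * g x - f b * g x) + (f' x * G x - f' x * G a)) has_integral
       (integral {a..b} (\<lambda>x. f x * g x) - f b * (G b - G a)) +
       (integral {a..b} (\<lambda>x. f' x * G x) - (f b - f a) * G a)) {a..b}"
      by (intro has_integral_add has_integral_diff i1 i2 i3 i4)
    also have "(integral {a..b} (\<lambda>x. f x * g x) - f b * (G b - G a)) +
       (integral {a..b} (\<lambda>x. f' x * G x) - (f b - f a) * G a) = H b - H a"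
      unfolding H_def split[OF fgi, symmetric] split[OF f'Gi, symmetric]
      by (simp add: algebra_simps)
    finally have I: "((\<lambda>x. (f x * g x - f b * g x) + (f' x * G x - f' x * G a)) has_integral H b - H a) (cbox a b)"
      by simp
    have "norm (H b - H a) \<le> (2 * L * C * (b - a)) * measure lborel (cbox a b)"
    proof (rule has_integral_bound[OF _ I])
      show "0 \<le> 2 * L * C * (b - a)" using L0 C0 ab by simp
      fix x assume "x \<in> cbox a b"
      then have x: "x \<in> {a..b}" by simp
      have "\<bar>(f x - f b) * g x\<bar> \<le> (L * (b - a)) * C"
        unfolding abs_mult using Lip[OF x] C[OF sub(1)[OF x]] by (intro mult_mono) auto
      moreover have "\<bar>f' x * (G x - G a)\<bar> \<le> L * (C * (b - a))"
        unfolding abs_mult using Gd(2)[OF x] L[OF sub(1)[OF x]] by (intro mult_mono) auto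
      ultimately show "norm ((f x * g x - f b * g x) + (f' x * G x - f' x * G a)) \<le> 2 * L * C * (b - a)"
        by (simp add: algebra_simps)
    qed
    then show ?thesis using ab by (simp add: power2_eq_square mult_ac)
  qed
  then have "H t = H 0"
    by (rule constant_on_if_quadratic_increments[OF t])
  then show ?thesis by (simp add: H_def G_def)
qed


text \<open>Both boundary terms vanish: the kernel is 0 at \<open>t\<close>, the primitive of
  \<open>g\<close> is 0 at 0. One degree of the kernel is traded for one integration.\<close>

lemma integral_monomial_kernel_by_parts:
  fixes g :: "real \<Rightarrow> real"
  assumes t: "0 \<le> t"
    and g: "g \<in> borel_measurable (lebesgue_on {0..t})"
    and C: "\<And>x. x \<in> {0..t} \<Longrightarrow> \<bar>g x\<bar> \<le> C"
  shows "integral {0..t} (\<lambda>x. (t - x) ^ Suc n / fact (Suc n) * g x) =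
    integral {0..t} (\<lambda>x. (t - x) ^ n / fact n * integral {0..x} g)"
proof -
  have "integral {0..t} (\<lambda>x. (t - x) ^ Suc n / fact (Suc n) * g x) =
      (t - t) ^ Suc n / fact (Suc n) * integral {0..t} g -
      integral {0..t} (\<lambda>x. - ((t - x) ^ n / fact n) * integral {0..x} g)"
  proof (rule integral_by_parts_bounded_measurable[OF t _ _ g C])
    show "((\<lambda>x. (t - x) ^ Suc n / fact (Suc n)) has_real_derivative - ((t - x) ^ n / fact n))
        (at x within {0..t})" for x
      by (auto intro!: derivative_eq_intros simp del: power_Suc simp: divide_simps)
    show "continuous_on {0..t} (\<lambda>x. - ((t - x) ^ n / fact n))"
      by (intro continuous_intros) auto
  qed
  then show ?thesis by simp
qed

section \<open>Repeated integration and Cauchy's formula\<close>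

text \<open>The output of the integrator number \<open>e\<close> of a chain driven by
  \<open>u\<close>, with initial values \<open>a\<close>; level 0 already contains one
  integration.\<close>

primrec iterated_integral :: "(real \<Rightarrow> real) \<Rightarrow> (nat \<Rightarrow> real) \<Rightarrow> nat \<Rightarrow> real \<Rightarrow> real" where
  "iterated_integral u a 0 s = a 0 + integral {0..s} u"
| "iterated_integral u a (Suc e) s = a (Suc e) + integral {0..s} (iterated_integral u a e)"

lemma continuous_on_iterated_integral:
  assumes "u integrable_on {0..t}"
  shows "continuous_on {0..t} (iterated_integral u a e)"
proof (induction e)
  case 0
  show ?case
    by (simp, intro continuous_intros indefinite_integral_continuous_1 assms)
next
  case (Suc e)
  show ?case
    by (simp, intro continuous_intros indefinite_integral_continuous_1
      integrable_continuous_interval Suc)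
qed

lemma iterated_integral_at_0 [simp]: "iterated_integral u a e 0 = a e"
  by (cases e) auto

text \<open>Superposition of the free motion from \<open>a\<close> and the response to
  \<open>u\<close> from rest.\<close>

lemma iterated_integral_affine:
  assumes u: "u integrable_on {0..t}" and s: "s \<in> {0..t}"
  shows "iterated_integral u a e s =
    iterated_integral (\<lambda>_. 0) a e s + iterated_integral u (\<lambda>_. 0) e s"
  using s
proof (induction e arbitrary: s)
  case (Suc e)
  have sub: "{0..s} \<subseteq> {0..t}" using Suc.prems by auto
  have "integral {0..s} (iterated_integral u a e) = integral {0..s}
      (\<lambda>x. iterated_integral (\<lambda>_. 0) a e x + iterated_integral u (\<lambda>_. 0) e x)"
    using Suc.prems by (intro integral_cong Suc.IH) auto
  also have "\<dots> = integral {0..s} (iterated_integral (\<lambda>_. 0) a e) +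
      integral {0..s} (iterated_integral u (\<lambda>_. 0) e)"
    by (intro Henstock_Kurzweil_Integration.integral_add integrable_continuous_interval
      continuous_on_subset[OF continuous_on_iterated_integral sub] u) auto
  finally show ?case by simp
qed simp

text \<open>For \<open>n = 0\<close> this is Cauchy's formula for repeated integration. General
  \<open>n\<close> makes the induction work: the hypothesis is applied at \<open>Suc n\<close>, and
  one integration by parts lowers the kernel to \<open>n\<close>.\<close>

lemma integral_kernel_eq_integral_iterated_integral:
  assumes t: "0 \<le> t"
    and u: "u \<in> borel_measurable (lebesgue_on {0..t})"
    and C: "\<And>x. x \<in> {0..t} \<Longrightarrow> \<bar>u x\<bar> \<le> C"
  shows "integral {0..t} (\<lambda>x. (t - x) ^ (n + Suc e) / fact (n + Suc e) * u x) =
    integral {0..t} (\<lambda>x. (t - x) ^ n / fact n * iterated_integral u (\<lambda>_. 0) e x)"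
proof (induction e arbitrary: n)
  case 0
  show ?case using integral_monomial_kernel_by_parts[OF t u C, of n] by simp
next
  case (Suc e)
  let ?J = "iterated_integral u (\<lambda>_. 0) e"
  have cont: "continuous_on {0..t} ?J"
    by (intro continuous_on_iterated_integral integrable_on_bounded_measurable[OF u C])
  then have "compact (?J ` {0..t})" by (intro compact_continuous_image) auto
  then obtain B where B: "\<And>x. x \<in> {0..t} \<Longrightarrow> \<bar>?J x\<bar> \<le> B"
    by (metis bounded_iff compact_imp_bounded image_eqI real_norm_def)
  have "integral {0..t} (\<lambda>x. (t - x) ^ (Suc n + Suc e) / fact (Suc n + Suc e) * u x) =
     integral {0..t} (\<lambda>x. (t - x) ^ Suc n / fact (Suc n) * ?J x)"
    by (rule Suc)
  also have "\<dots> = integral {0..t} (\<lambda>x. (t - x) ^ n / fact n * integral {0..x} ?J)"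
    by (rule integral_monomial_kernel_by_parts[OF t borel_measurable_lebesgue_on_continuous[OF cont] B])
  finally show ?case by simp
qed

lemma iterated_integral_eq_kernel_integral:
  assumes t: "0 \<le> t"
    and u: "u \<in> borel_measurable (lebesgue_on {0..t})"
    and C: "\<And>x. x \<in> {0..t} \<Longrightarrow> \<bar>u x\<bar> \<le> C"
  shows "iterated_integral u a e t = iterated_integral (\<lambda>_. 0) a e t +
    integral {0..t} (\<lambda>x. (t - x) ^ e / fact e * u x)"
proof -
  have "iterated_integral u (\<lambda>_. 0) e t = integral {0..t} (\<lambda>x. (t - x) ^ e / fact e * u x)"
  proof (cases e)
    case (Suc e')
    show ?thesis
      using integral_kernel_eq_integral_iterated_integral[OF t u C, of 0 e'] Suc by simp
  qed simp
  then show ?thesis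
    using iterated_integral_affine[OF integrable_on_bounded_measurable[OF u C], of t a e] t by simp
qed

section \<open>The integrator as a chain of coordinates\<close>

text \<open>Coordinates are counted from the last one, where the control enters. With this numbering
  \<open>num_above i\<close> is both the level of \<open>iterated_integral\<close> and the degree of
  the kernel that belong to coordinate \<open>i\<close>.\<close>

definition num_above :: "'n::{finite,wellorder} \<Rightarrow> nat" where
  "num_above i = card {j. i < j}"

lemma coord_no_above: "coord_no i + num_above i = CARD('n)" for i :: "'n::{finite,wellorder}"
proof -
  have "card ({j. j \<le> i} \<union> {j. i < j}) = coord_no i + num_above i"
    unfolding coord_no_def num_above_def by (rule card_Un_disjoint) auto
  moreover have "{j. j \<le> i} \<union> {j. i < j} = UNIV" by auto
  ultimately show ?thesis by simp
qed

lemma coord_no_pos: "0 < coord_no i" for i :: "'n::{finite,wellorder}"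
  unfolding coord_no_def by (auto simp: card_gt_0_iff)

lemma above_less_card: "num_above i < CARD('n)" for i :: "'n::{finite,wellorder}"
  using coord_no_above[of i] coord_no_pos[of i] by simp

lemma above_strict_antimono: "i < j \<Longrightarrow> num_above j < num_above i" for i :: "'n::{finite,wellorder}"
  unfolding num_above_def by (rule psubset_card_mono) auto

lemma inj_above: "inj (num_above :: 'n::{finite,wellorder} \<Rightarrow> nat)"
  by (rule injI) (metis above_strict_antimono less_irrefl neqE)

lemma bij_betw_above: "bij_betw (num_above :: 'n::{finite,wellorder} \<Rightarrow> nat) UNIV {..<CARD('n)}"
proof -
  have "range (num_above :: 'n \<Rightarrow> nat) = {..<CARD('n)}"
    by (rule card_subset_eq) (auto simp: above_less_card card_image[OF inj_above])
  then show ?thesis by (simp add: bij_betw_def inj_above)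
qed

definition at_above :: "nat \<Rightarrow> 'n::{finite,wellorder}" where
  "at_above = inv num_above"

lemma at_above_above [simp]: "at_above (num_above i) = i"
  unfolding at_above_def by (rule inv_f_f[OF inj_above])

lemma above_at_above [simp]: "e < CARD('n) \<Longrightarrow> num_above (at_above e :: 'n::{finite,wellorder}) = e"
  unfolding at_above_def using bij_betw_above[where 'n='n]
  by (intro f_inv_into_f) (auto simp: bij_betw_def)

lemma integrator_rhs_nth:
  fixes x :: "real ^ 'n::{finite,wellorder}"
  shows "(integrator_A *v x + v *\<^sub>R integrator_b) $ i =
    (if num_above i = 0 then v else x $ at_above (num_above i - 1))"
proof -
  \<comment> \<open>Truncated subtraction does no harm: for \<open>coord_no j = 1\<close> the right
    side is 0, which is no coordinate number, in accordance with the zero first column.\<close>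
  have idx: "coord_no i = coord_no j - 1 \<longleftrightarrow> num_above i = Suc (num_above j)" for j :: 'n
    using coord_no_above[of i] coord_no_above[of j] coord_no_pos[of j] coord_no_pos[of i] by auto
  have "(integrator_A *v x) $ i = (\<Sum>j\<in>UNIV. if num_above i = Suc (num_above j) then x $ j else 0)"
    unfolding integrator_A_def matrix_vector_mult_def
    by (auto simp: std_basis_def idx[simplified] intro!: sum.cong)
  also have "\<dots> = (if num_above i = 0 then 0 else x $ at_above (num_above i - 1))"
  proof (cases "num_above i")
    case (Suc e)
    have "e < CARD('n)" using above_less_card[of i] Suc by simp
    then have "num_above i = Suc (num_above j) \<longleftrightarrow> j = at_above e" for j :: 'n
      using Suc above_at_above[of e, where 'n='n] by (metis at_above_above nat.inject)
    then show ?thesis using Suc by simp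
  qed simp
  finally have A: "(integrator_A *v x) $ i = (if num_above i = 0 then 0 else x $ at_above (num_above i - 1))" .
  have "coord_no i = CARD('n) \<longleftrightarrow> num_above i = 0"
    using coord_no_above[of i] by auto
  then show ?thesis
    using A by (auto simp: integrator_b_def std_basis_def)
qed

lemma has_integral_vec_iff:
  fixes f :: "real \<Rightarrow> real ^ 'n"
  shows "(f has_integral y) S \<longleftrightarrow> (\<forall>i. ((\<lambda>x. f x $ i) has_integral y $ i) S)"
  by (subst has_integral_componentwise_iff) (auto simp: Basis_vec_def cart_eq_inner_axis)

lemma admissible_control_integrable:
  assumes "admissible_control \<mu> t u"
  shows "u \<in> borel_measurable (lebesgue_on {0..t})" "\<And>x. x \<in> {0..t} \<Longrightarrow> \<bar>u x\<bar> \<le> \<mu>"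
    "u integrable_on {0..t}"
proof -
  show *: "u \<in> borel_measurable (lebesgue_on {0..t})" "\<And>x. x \<in> {0..t} \<Longrightarrow> \<bar>u x\<bar> \<le> \<mu>"
    using assms unfolding admissible_control_def by (auto simp: abs_le_iff minus_le_iff)
  show "u integrable_on {0..t}" by (rule integrable_on_bounded_measurable[OF *])
qed

lemma integrator_solution_nth_has_integral:
  fixes x :: "real \<Rightarrow> real ^ 'n::{finite,wellorder}"
  assumes x: "integrator_solution t u x" and s: "s \<in> {0..t}"
  shows "((\<lambda>\<tau>. if num_above i = 0 then u \<tau> else x \<tau> $ at_above (num_above i - 1))
    has_integral (x s $ i - x 0 $ i)) {0..s}"
proof -
  have "((\<lambda>\<tau>. (integrator_A *v x \<tau> + u \<tau> *\<^sub>R integrator_b) $ i) has_integral (x s - x 0) $ i) {0..s}"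
    using x s unfolding integrator_solution_def has_integral_vec_iff by blast
  then show ?thesis unfolding integrator_rhs_nth by simp
qed

text \<open>Uniqueness for a given control and initial point, by induction along the chain: the
  integral equation of a coordinate contains only the coordinate, or the control, that drives
  it.\<close>

lemma integrator_solution_nth:
  fixes x :: "real \<Rightarrow> real ^ 'n::{finite,wellorder}"
  assumes x: "integrator_solution t u x" and s: "s \<in> {0..t}"
  shows "x s $ i = iterated_integral u (\<lambda>e. x 0 $ at_above e) (num_above i) s"
  using s
proof (induction "num_above i" arbitrary: i s)
  case 0
  have "((\<lambda>\<tau>. u \<tau>) has_integral (x s $ i - x 0 $ i)) {0..s}"
    using integrator_solution_nth_has_integral[OF x 0(2), of i] 0(1) by simp
  then have "integral {0..s} u = x s $ i - x 0 $ i" by (rule integral_unique)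
  then show ?case using 0 at_above_above[of i] by simp
next
  case (Suc e)
  have e: "e < CARD('n)" using above_less_card[of i] Suc by simp
  have "((\<lambda>\<tau>. x \<tau> $ at_above e) has_integral (x s $ i - x 0 $ i)) {0..s}"
    using integrator_solution_nth_has_integral[OF x Suc.prems, of i]
    by (simp flip: Suc.hyps(2))
  then have "x s $ i - x 0 $ i = integral {0..s} (\<lambda>\<tau>. x \<tau> $ at_above e)"
    by (simp add: integral_unique)
  also have "\<dots> = integral {0..s} (iterated_integral u (\<lambda>e. x 0 $ at_above e) e)"
    using Suc.hyps(1)[of "at_above e"] Suc.prems e by (intro integral_cong) auto
  finally show ?case
    using Suc.hyps(2) at_above_above[of i] by (simp flip: Suc.hyps(2))
qed

lemma integrator_solution_exists:
  fixes x0 :: "real ^ 'n::{finite,wellorder}"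
  assumes u: "u integrable_on {0..t}"
  shows "\<exists>x. integrator_solution t u x \<and> x 0 = x0"
proof -
  define a where "a e = x0 $ at_above e" for e
  define x :: "real \<Rightarrow> (real, 'n) vec" where "x s = (\<chi> i. iterated_integral u a (num_above i) s)" for s
  have "x 0 = x0" by (simp add: x_def a_def vec_eq_iff)
  moreover have "integrator_solution t u x"
    unfolding integrator_solution_def has_integral_vec_iff
  proof (intro ballI allI)
    fix s and i :: 'n assume s: "s \<in> {0..t}"
    then have sub: "{0..s} \<subseteq> {0..t}" by auto
    show "((\<lambda>\<tau>. (integrator_A *v x \<tau> + u \<tau> *\<^sub>R integrator_b) $ i) has_integral (x s - x 0) $ i) {0..s}"
    proof (cases "num_above i")
      case 0
      then show ?thesis
        using integrable_on_subinterval[OF u sub]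
        by (simp add: integrator_rhs_nth del: vector_add_component vector_scaleR_component add: x_def has_integral_integral)
    next
      case (Suc e)
      have e: "e < CARD('n)" using above_less_card[of i] Suc by simp
      have "iterated_integral u a e integrable_on {0..s}"
        by (intro integrable_continuous_interval
            continuous_on_subset[OF continuous_on_iterated_integral sub] u)
      then show ?thesis
        using e by (simp add: integrator_rhs_nth del: vector_add_component vector_scaleR_component add: Suc x_def has_integral_integral)
    qed
  qed
  ultimately show ?thesis by blast
qed

text \<open>The entry of exp((t - x) A) b in the coordinate with \<open>e\<close> others above it,
  because A^e b is the basis vector of that coordinate.\<close>

definition duhamel_kernel :: "real \<Rightarrow> nat \<Rightarrow> real \<Rightarrow> real" where
  "duhamel_kernel t e x = (t - x) ^ e / fact e"

definition moment_map :: "real \<Rightarrow> (real \<Rightarrow> real) \<Rightarrow> real ^ 'n::{finite,wellorder}" where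
  "moment_map t u = (\<chi> i. integral {0..t} (\<lambda>x. duhamel_kernel t (num_above i) x * u x))"

lemma reach_set_eq_translation:
  fixes x0 :: "real ^ 'n::{finite,wellorder}"
  assumes t: "0 \<le> t"
  obtains y where "reach_set \<mu> {x0} t = (+) y ` (moment_map t ` {u. admissible_control \<mu> t u})"
proof
  \<comment> \<open>The free motion exp(t A) x0, common to all controls.\<close>
  define y :: "(real, 'n) vec" where
    "y = (\<chi> i. iterated_integral (\<lambda>_. 0) (\<lambda>e. x0 $ at_above e) (num_above i) t)"
  have *: "x t = y + moment_map t u"
    if "integrator_solution t u x" "x 0 = x0" "admissible_control \<mu> t u" for u x
    using integrator_solution_nth[OF that(1), of t] t that(2)
      iterated_integral_eq_kernel_integral[OF t admissible_control_integrable(1,2)[OF that(3)]]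
    by (simp add: vec_eq_iff y_def moment_map_def duhamel_kernel_def)
  show "reach_set \<mu> {x0} t = (+) y ` (moment_map t ` {u. admissible_control \<mu> t u})"
  proof (intro subset_antisym subsetI)
    fix z assume "z \<in> reach_set \<mu> {x0} t"
    then show "z \<in> (+) y ` (moment_map t ` {u. admissible_control \<mu> t u})"
      unfolding reach_set_def using * by fastforce
  next
    fix z assume "z \<in> (+) y ` (moment_map t ` {u. admissible_control \<mu> t u})"
    then obtain u where u: "admissible_control \<mu> t u" "z = y + moment_map t u" by auto
    obtain x where "integrator_solution t u x" "x 0 = x0"
      using integrator_solution_exists[OF admissible_control_integrable(3)[OF u(1)]] by blast
    then show "z \<in> reach_set \<mu> {x0} t"
      unfolding reach_set_def using * u by fastforce
  qed
qed

section \<open>The convex set of moments and bang-bang controls\<close>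

lemma continuous_on_kernel: "continuous_on S (duhamel_kernel t e)"
  unfolding duhamel_kernel_def by (intro continuous_intros) auto

lemma kernel_times_control_integrable:
  assumes "admissible_control \<mu> t u"
  shows "(\<lambda>x. duhamel_kernel t e x * u x) integrable_on {0..t}"
  by (rule integrable_on_continuous_times[OF continuous_on_kernel admissible_control_integrable(1,2)[OF assms]])

text \<open>The function against which a control is integrated when the functional \<open>a\<close>
  is applied to its moments. As \<open>a\<close> varies it runs through all polynomials of degree
  less than \<open>CARD('n)\<close>.\<close>

definition kernel_comb :: "real \<Rightarrow> real ^ 'n::{finite,wellorder} \<Rightarrow> real \<Rightarrow> real" where
  "kernel_comb t a x = (\<Sum>i\<in>UNIV. a $ i * duhamel_kernel t (num_above i) x)"

lemma continuous_on_kernel_comb: "continuous_on S (kernel_comb t a)"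
  unfolding kernel_comb_def by (intro continuous_intros continuous_on_kernel)

lemma kernel_comb_times_control_integrable:
  assumes "admissible_control \<mu> t u"
  shows "(\<lambda>x. kernel_comb t a x * u x) integrable_on {0..t}"
  by (rule integrable_on_continuous_times[OF continuous_on_kernel_comb admissible_control_integrable(1,2)[OF assms]])

lemma inner_moment_map:
  assumes "admissible_control \<mu> t u"
  shows "a \<bullet> moment_map t u = integral {0..t} (\<lambda>x. kernel_comb t a x * u x)"
proof -
  have "integral {0..t} (\<lambda>x. kernel_comb t a x * u x) =
      integral {0..t} (\<lambda>x. \<Sum>i\<in>UNIV. a $ i * (duhamel_kernel t (num_above i) x * u x))"
    by (simp add: kernel_comb_def sum_distrib_right mult.assoc)
  also have "\<dots> = (\<Sum>i\<in>UNIV. integral {0..t} (\<lambda>x. a $ i * (duhamel_kernel t (num_above i) x * u x)))"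
    using kernel_times_control_integrable[OF assms]
    by (intro integral_sum) (auto intro!: integrable_on_mult_right)
  also have "\<dots> = a \<bullet> moment_map t u"
    by (simp add: inner_vec_def moment_map_def)
  finally show ?thesis by simp
qed

lemma kernel_comb_polynomial:
  fixes r :: "real poly"
  assumes "degree r < CARD('n)"
  obtains a :: "(real, 'n::{finite,wellorder}) vec" where "\<And>x. kernel_comb t a x = poly r (t - x)"
proof
  let ?a = "(\<chi> i. fact (num_above i) * coeff r (num_above i)) :: (real, 'n) vec"
  fix x
  have "poly r (t - x) = (\<Sum>k\<le>degree r. coeff r k * (t - x) ^ k)"
    by (rule poly_altdef)
  also have "\<dots> = (\<Sum>k<CARD('n). coeff r k * (t - x) ^ k)"
    using assms by (intro sum.mono_neutral_left) (auto simp: coeff_eq_0)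
  also have "\<dots> = (\<Sum>i\<in>(UNIV :: 'n set). coeff r (num_above i) * (t - x) ^ num_above i)"
    by (rule sum.reindex_bij_betw[OF bij_betw_above, symmetric])
  also have "\<dots> = kernel_comb t ?a x"
    unfolding kernel_comb_def duhamel_kernel_def by (intro sum.cong) auto
  finally show "kernel_comb t ?a x = poly r (t - x)" by simp
qed

text \<open>The kernels are powers of t - x, so the node products are rewritten in that variable by
  x - s_l = (t - s_l) - (t - x); this is the origin of the sign of the leading coefficient.\<close>

lemma node_polynomial:
  fixes s :: "'a \<Rightarrow> real" and t :: real
  assumes "finite L"
  defines "r \<equiv> (\<Prod>l\<in>L. [:t - s l, -1:])"
  shows "poly r (t - x) = (\<Prod>l\<in>L. x - s l)" "degree r = card L" "coeff r (card L) = (-1) ^ card L"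
proof -
  show "poly r (t - x) = (\<Prod>l\<in>L. x - s l)"
    by (simp add: r_def poly_prod)
  show deg: "degree r = card L"
    unfolding r_def by (subst degree_prod_sum_eq) auto
  show "coeff r (card L) = (-1) ^ card L"
    using lead_coeff_prod[of "\<lambda>l. [:t - s l, -1:]" L] unfolding r_def[symmetric] deg by simp
qed

lemma kernel_comb_nodes:
  fixes s :: "real ^ 'n::{finite,wellorder}"
  assumes "L \<noteq> UNIV"
  obtains a :: "(real, 'n) vec" where "\<And>x. kernel_comb t a x = (\<Prod>l\<in>L. x - s $ l)"
proof -
  have "card L < CARD('n)" using assms by (intro psubset_card_mono) auto
  then have "degree (\<Prod>l\<in>L. [:t - s $ l, -1:]) < CARD('n)"
    by (simp add: node_polynomial(2))
  then obtain a :: "(real, 'n) vec" where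
      "\<And>x. kernel_comb t a x = poly (\<Prod>l\<in>L. [:t - s $ l, -1:]) (t - x)"
    using kernel_comb_polynomial by blast
  then show ?thesis using that[of a] by (simp add: node_polynomial(1))
qed

lemma kernel_comb_nodes_diff:
  fixes s s' :: "real ^ 'n::{finite,wellorder}"
  obtains a :: "(real, 'n) vec" where
    "\<And>x. kernel_comb t a x = (\<Prod>l\<in>UNIV. x - s $ l) - (\<Prod>l\<in>UNIV. x - s' $ l)"
proof -
  define r where "r z = (\<Prod>l\<in>UNIV. [:t - z $ l, -1:])" for z :: "(real, 'n) vec"
  have r: "poly (r z) (t - x) = (\<Prod>l\<in>UNIV. x - z $ l)" "degree (r z) = CARD('n)"
    "coeff (r z) (CARD('n)) = (-1) ^ CARD('n)" for z x
    using node_polynomial[of UNIV t "($) z"] unfolding r_def by auto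
  have "degree (r s - r s') < CARD('n)"
  proof -
    have "degree (r s - r s') \<le> CARD('n)" using degree_diff_le[of "r s"] r(2) by auto
    moreover have "coeff (r s - r s') (CARD('n)) = 0" by (simp add: r)
    ultimately show ?thesis
      \<comment> \<open>If the difference is the zero polynomial, its degree is 0, again below
        \<open>CARD('n)\<close>.\<close>
      by (metis eq_zero_or_degree_less zero_less_card_finite degree_0)
  qed
  then obtain a :: "(real, 'n) vec" where "\<And>x. kernel_comb t a x = poly (r s - r s') (t - x)"
    using kernel_comb_polynomial by blast
  then show ?thesis using that[of a] by (simp add: r(1))
qed

definition reach_kernel_set :: "real \<Rightarrow> real \<Rightarrow> (real ^ 'n::{finite,wellorder}) set" where
  "reach_kernel_set \<mu> t = moment_map t ` {u. admissible_control \<mu> t u}"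

lemma convex_reach_kernel_set:
  "convex (reach_kernel_set \<mu> t :: (real ^ 'n::{finite,wellorder}) set)"
proof (rule convexI)
  fix y z :: "(real, 'n) vec" and \<alpha> \<beta> :: real
  assume "y \<in> reach_kernel_set \<mu> t" "z \<in> reach_kernel_set \<mu> t" and ab: "0 \<le> \<alpha>" "0 \<le> \<beta>" "\<alpha> + \<beta> = 1"
  then obtain u v where u: "admissible_control \<mu> t u" "y = moment_map t u"
    and v: "admissible_control \<mu> t v" "z = moment_map t v"
    unfolding reach_kernel_set_def by auto
  let ?w = "\<lambda>x. \<alpha> * u x + \<beta> * v x"
  have "admissible_control \<mu> t ?w"
    unfolding admissible_control_def
  proof (intro conjI ballI)
    show "?w \<in> borel_measurable (lebesgue_on {0..t})"
      using admissible_control_integrable(1)[OF u(1)] admissible_control_integrable(1)[OF v(1)]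
      by measurable
    fix x assume x: "x \<in> {0..t}"
    have "\<alpha> *\<^sub>R u x + \<beta> *\<^sub>R v x \<in> {-\<mu>..\<mu>}"
      using u(1) v(1) x unfolding admissible_control_def
      by (intro convexD[OF _ _ _ ab]) auto
    then show "?w x \<in> {-\<mu>..\<mu>}" by simp
  qed
  moreover have "\<alpha> *\<^sub>R y + \<beta> *\<^sub>R z = moment_map t ?w"
  proof -
    have "integral {0..t} (\<lambda>x. duhamel_kernel t e x * ?w x) =
        \<alpha> * integral {0..t} (\<lambda>x. duhamel_kernel t e x * u x) + \<beta> * integral {0..t} (\<lambda>x. duhamel_kernel t e x * v x)" for e
    proof -
      have "integral {0..t} (\<lambda>x. duhamel_kernel t e x * ?w x) =
          integral {0..t} (\<lambda>x. \<alpha> * (duhamel_kernel t e x * u x) + \<beta> * (duhamel_kernel t e x * v x))"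
        by (simp add: algebra_simps)
      also have "\<dots> = integral {0..t} (\<lambda>x. \<alpha> * (duhamel_kernel t e x * u x)) +
          integral {0..t} (\<lambda>x. \<beta> * (duhamel_kernel t e x * v x))"
        using kernel_times_control_integrable[OF u(1)] kernel_times_control_integrable[OF v(1)]
        by (intro Henstock_Kurzweil_Integration.integral_add integrable_on_mult_right) auto
      finally show ?thesis by simp
    qed
    then show ?thesis by (simp add: u v vec_eq_iff moment_map_def)
  qed
  ultimately show "\<alpha> *\<^sub>R y + \<beta> *\<^sub>R z \<in> reach_kernel_set \<mu> t"
    unfolding reach_kernel_set_def by auto
qed

lemma bounded_reach_kernel_set:
  "bounded (reach_kernel_set \<mu> t :: (real ^ 'n::{finite,wellorder}) set)"
proof -
  have "\<exists>B. \<forall>u. admissible_control \<mu> t u \<longrightarrow> \<bar>(moment_map t u :: (real, 'n) vec) $ i\<bar> \<le> B" for i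
  proof (intro exI allI impI)
    fix u assume u: "admissible_control \<mu> t u"
    have "norm (integral {0..t} (\<lambda>x. duhamel_kernel t (num_above i) x * u x))
       \<le> integral {0..t} (\<lambda>x. \<bar>duhamel_kernel t (num_above i) x\<bar> * \<mu>)"
    proof (rule integral_norm_bound_integral)
      show "(\<lambda>x. \<bar>duhamel_kernel t (num_above i) x\<bar> * \<mu>) integrable_on {0..t}"
        by (intro integrable_continuous_interval continuous_intros continuous_on_kernel)
      show "norm (duhamel_kernel t (num_above i) x * u x) \<le> \<bar>duhamel_kernel t (num_above i) x\<bar> * \<mu>" if "x \<in> {0..t}" for x
        using admissible_control_integrable(2)[OF u that] by (auto simp: abs_mult intro!: mult_left_mono)
    qed (rule kernel_times_control_integrable[OF u])
    then show "\<bar>(moment_map t u :: (real, 'n) vec) $ i\<bar> \<le> integral {0..t} (\<lambda>x. \<bar>duhamel_kernel t (num_above i) x\<bar> * \<mu>)"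
      by (simp add: moment_map_def)
  qed
  then obtain B where B: "\<And>i u. admissible_control \<mu> t u \<Longrightarrow> \<bar>(moment_map t u :: (real, 'n) vec) $ i\<bar> \<le> B i"
    by metis
  show ?thesis
    unfolding bounded_iff
  proof (intro exI ballI)
    fix y :: "(real, 'n) vec" assume "y \<in> reach_kernel_set \<mu> t"
    then have "\<And>i. \<bar>y $ i\<bar> \<le> B i" using B unfolding reach_kernel_set_def by auto
    then show "norm y \<le> (\<Sum>i\<in>UNIV. B i)"
      using norm_le_l1_cart[of y] by (meson order_trans sum_mono)
  qed
qed

text \<open>No control exceeds the integrand of \<open>v\<close> outside the finite set
  \<open>F\<close>, so \<open>moment_map t v\<close> maximizes the functional \<open>a\<close>; from
  an interior point one could still move in the direction \<open>a\<close>. The set \<open>F\<close>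
  admits switching times, where the control takes the value 0.\<close>

lemma not_interior_if_extremal:
  fixes a :: "real ^ 'n::{finite,wellorder}"
  assumes v: "admissible_control \<mu> t v" and F: "finite F"
    and extr: "\<And>x. x \<in> {0..t} - F \<Longrightarrow> kernel_comb t a x * v x = \<mu> * \<bar>kernel_comb t a x\<bar>"
    and a: "a \<noteq> 0"
  shows "moment_map t v \<notin> interior (reach_kernel_set \<mu> t :: (real, 'n) vec set)"
proof
  let ?y = "moment_map t v :: (real, 'n) vec"
  assume "?y \<in> interior (reach_kernel_set \<mu> t)"
  then obtain e where e: "0 < e" "cball ?y e \<subseteq> reach_kernel_set \<mu> t"
    unfolding mem_interior_cball by (elim exE conjE)
  have max: "a \<bullet> z \<le> a \<bullet> ?y" if z: "z \<in> reach_kernel_set \<mu> t" for z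
  proof -
    obtain u where u: "admissible_control \<mu> t u" "z = moment_map t u"
      using z unfolding reach_kernel_set_def by auto
    have "integral {0..t} (\<lambda>x. kernel_comb t a x * u x) \<le> integral {0..t} (\<lambda>x. \<mu> * \<bar>kernel_comb t a x\<bar>)"
    proof (rule integral_le)
      show "(\<lambda>x. \<mu> * \<bar>kernel_comb t a x\<bar>) integrable_on {0..t}"
        by (intro integrable_continuous_interval continuous_intros continuous_on_kernel_comb)
      fix x assume "x \<in> {0..t}"
      then have "\<bar>kernel_comb t a x * u x\<bar> \<le> \<bar>kernel_comb t a x\<bar> * \<mu>"
        using admissible_control_integrable(2)[OF u(1)] by (auto simp: abs_mult intro!: mult_left_mono)
      then show "kernel_comb t a x * u x \<le> \<mu> * \<bar>kernel_comb t a x\<bar>" by (simp add: mult.commute)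
    qed (rule kernel_comb_times_control_integrable[OF u(1)])
    also have "integral {0..t} (\<lambda>x. \<mu> * \<bar>kernel_comb t a x\<bar>) =
        integral {0..t} (\<lambda>x. kernel_comb t a x * v x)"
      by (rule integral_spike[OF negligible_finite[OF F]]) (use extr in auto)
    finally show ?thesis using inner_moment_map[OF u(1), of a] inner_moment_map[OF v, of a] u by simp
  qed
  let ?z = "?y + (e / norm a) *\<^sub>R a"
  have "?z \<in> cball ?y e" using a e by (simp add: dist_norm)
  then have "a \<bullet> ?z \<le> a \<bullet> ?y" by (intro max subsetD[OF e(2)])
  moreover have "a \<bullet> ?z = a \<bullet> ?y + e / norm a * (a \<bullet> a)" by (simp add: inner_add_right)
  ultimately have "e / norm a * (a \<bullet> a) \<le> 0" by simp
  moreover have "e / norm a * (a \<bullet> a) > 0" using a e by (intro mult_pos_pos divide_pos_pos) auto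
  ultimately show False by linarith
qed

section \<open>Bang-bang controls and their switching times\<close>

definition bang_bang :: "real \<Rightarrow> real ^ 'n \<Rightarrow> real \<Rightarrow> real" where
  "bang_bang \<mu> s x = \<mu> * sgn (\<Prod>l\<in>UNIV. x - s $ l)"

lemma admissible_bang_bang:
  fixes s :: "real ^ 'n"
  assumes "0 \<le> \<mu>"
  shows "admissible_control \<mu> t (bang_bang \<mu> s)"
  unfolding admissible_control_def
proof (intro conjI ballI)
  have "(\<lambda>x. sgn (\<Prod>l\<in>UNIV. x - s $ l)) \<in> borel_measurable borel"
    unfolding sgn_real_def by measurable
  then have "bang_bang \<mu> s \<in> borel_measurable lborel"
    unfolding bang_bang_def by measurable
  then show "bang_bang \<mu> s \<in> borel_measurable (lebesgue_on {0..t})"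
    by (intro measurable_restrict_space1 measurable_completion)
  show "bang_bang \<mu> s x \<in> {-\<mu>..\<mu>}" for x
    using assms by (auto simp: bang_bang_def sgn_real_def)
qed

definition switch_simplex :: "real \<Rightarrow> (real ^ 'n::{finite,wellorder}) set" where
  "switch_simplex t = {s. (\<forall>i. 0 < s $ i \<and> s $ i < t) \<and> (\<forall>i j. i < j \<longrightarrow> s $ i < s $ j)}"

definition closed_switch_simplex :: "real \<Rightarrow> (real ^ 'n::{finite,wellorder}) set" where
  "closed_switch_simplex t = {s. (\<forall>i. 0 \<le> s $ i \<and> s $ i \<le> t) \<and> (\<forall>i j. i < j \<longrightarrow> s $ i \<le> s $ j)}"

lemma switch_simplex_subset: "switch_simplex t \<subseteq> closed_switch_simplex t"
  unfolding switch_simplex_def closed_switch_simplex_def by (auto intro: less_imp_le)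

lemma open_switch_simplex: "open (switch_simplex t)"
proof -
  have "switch_simplex t = (\<Inter>i. {s. 0 < s $ i}) \<inter> (\<Inter>i. {s. s $ i < t}) \<inter>
     (\<Inter>(i,j)\<in>{(i,j). i < j}. {s. s $ i < s $ j})"
    unfolding switch_simplex_def by auto
  also have "open \<dots>"
    by (intro open_Int open_INT ballI) (auto intro!: open_Collect_less continuous_intros)
  finally show ?thesis .
qed

lemma compact_closed_switch_simplex: "compact (closed_switch_simplex t)"
proof -
  have "closed_switch_simplex t = cbox 0 (\<chi> i. t) \<inter> (\<Inter>(i,j)\<in>{(i,j). i < j}. {s. s $ i \<le> s $ j})"
    unfolding closed_switch_simplex_def by (auto simp: mem_box_cart)
  also have "compact \<dots>"
    by (intro compact_Int_closed compact_cbox closed_INT) (auto intro!: closed_Collect_le continuous_intros)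
  finally show ?thesis .
qed

lemma nonempty_switch_simplex:
  assumes "t > 0"
  shows "(switch_simplex t :: (real ^ 'n::{finite,wellorder}) set) \<noteq> {}"
proof -
  let ?s = "(\<chi> i. t * (coord_no i / (CARD('n) + 1))) :: (real, 'n) vec"
  have *: "coord_no i \<le> CARD('n)" "0 < coord_no i" "i < j \<Longrightarrow> coord_no i < coord_no j" for i j :: 'n
    using coord_no_above[of i] coord_no_above[of j] coord_no_pos[of i] above_strict_antimono[of i j]
    by auto
  moreover have "real (coord_no i) < 1 + real CARD('n)" for i :: 'n
    using *(1)[of i] by linarith
  ultimately have "?s \<in> switch_simplex t"
    unfolding switch_simplex_def using assms
    by (auto simp: divide_simps zero_less_mult_iff intro!: mult_strict_left_mono)
  then show ?thesis by auto
qed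

text \<open>On the faces of the simplex at least one switch is lost, so the control is a maximizer of
  a nonzero linear functional.\<close>

lemma bang_bang_boundary_not_interior:
  fixes s :: "real ^ 'n::{finite,wellorder}"
  assumes \<mu>: "0 \<le> \<mu>" and s: "s \<in> closed_switch_simplex t - switch_simplex t"
  shows "moment_map t (bang_bang \<mu> s) \<notin> interior (reach_kernel_set \<mu> t :: (real, 'n) vec set)"
proof -
  have key: ?thesis if L: "L \<noteq> UNIV" and c: "c \<noteq> 0" "finite F"
    and sg: "\<And>x. x \<in> {0..t} - F \<Longrightarrow> sgn (\<Prod>l\<in>UNIV. x - s $ l) = sgn (c * (\<Prod>l\<in>L. x - s $ l))"
  for L and c :: real and F
  proof -
    obtain a :: "(real, 'n) vec" where a: "\<And>x. kernel_comb t a x = (\<Prod>l\<in>L. x - s $ l)"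
      using kernel_comb_nodes[OF L] by metis
    have ca: "kernel_comb t (c *\<^sub>R a) x = c * (\<Prod>l\<in>L. x - s $ l)" for x
      using a[of x] unfolding kernel_comb_def by (simp add: sum_distrib_left[symmetric] mult.assoc)
    \<comment> \<open>Off the switching times the product over \<open>L\<close> is nonzero, so the
      functional is not zero.\<close>
    obtain x where "x \<notin> range (($) s)"
      using ex_new_if_finite[of "range (($) s)"] by (auto simp: infinite_UNIV_char_0)
    then have "kernel_comb t (c *\<^sub>R a) x \<noteq> 0" using c by (auto simp: ca)
    then have "c *\<^sub>R a \<noteq> 0" by (auto simp: kernel_comb_def)
    moreover have "kernel_comb t (c *\<^sub>R a) x * bang_bang \<mu> s x = \<mu> * \<bar>kernel_comb t (c *\<^sub>R a) x\<bar>"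
      if "x \<in> {0..t} - F" for x
      unfolding bang_bang_def sg[OF that] ca abs_sgn by (simp only: mult_ac)
    ultimately show ?thesis
      using not_interior_if_extremal[OF admissible_bang_bang[OF \<mu>] c(2)] by blast
  qed
  have split: "(\<Prod>l\<in>UNIV. x - s $ l) = (x - s $ i) * (\<Prod>l\<in>UNIV-{i}. x - s $ l)" for x i
    by (rule prod.remove) auto
  have "(\<exists>i. s $ i = 0) \<or> (\<exists>i. s $ i = t) \<or> (\<exists>i j. i < j \<and> s $ i = s $ j)"
  proof (rule ccontr)
    assume "\<not> ?thesis"
    then have "s \<in> switch_simplex t"
      using s unfolding closed_switch_simplex_def switch_simplex_def by (simp add: order_less_le[where 'a=real])
    then show False using s by simp
  qed
  then consider i where "s $ i = 0" | i where "s $ i = t" | i j where "i < j" "s $ i = s $ j"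
    by blast
  then show ?thesis
  proof cases
    case (1 i)
    show ?thesis
    proof (rule key)
      show "sgn (\<Prod>l\<in>UNIV. x - s $ l) = sgn (1 * (\<Prod>l\<in>UNIV-{i}. x - s $ l))"
        if "x \<in> {0..t} - {0}" for x
      proof -
        have "sgn (x - s $ i) = 1" using 1 that by simp
        then show ?thesis unfolding split[of x i] sgn_mult by simp
      qed
    qed auto
  next
    case (2 i)
    show ?thesis
    proof (rule key)
      show "sgn (\<Prod>l\<in>UNIV. x - s $ l) = sgn (- 1 * (\<Prod>l\<in>UNIV-{i}. x - s $ l))"
        if "x \<in> {0..t} - {t}" for x
      proof -
        have "sgn (x - s $ i) = -1" using 2 that by simp
        then show ?thesis unfolding split[of x i] sgn_mult by simp
      qed
    qed auto
  next
    case (3 i j)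
    show ?thesis
    proof (rule key)
      show "sgn (\<Prod>l\<in>UNIV. x - s $ l) = sgn (1 * (\<Prod>l\<in>UNIV-{i}-{j}. x - s $ l))"
        if "x \<in> {0..t} - {s $ j}" for x
      proof -
        have "(\<Prod>l\<in>UNIV-{i}. x - s $ l) = (x - s $ j) * (\<Prod>l\<in>UNIV-{i}-{j}. x - s $ l)"
          using 3 by (intro prod.remove) auto
        moreover have "sgn (x - s $ i) * sgn (x - s $ j) = 1"
          using 3 that by (simp add: sgn_if)
        ultimately show ?thesis
          unfolding split[of x i] by (simp add: sgn_mult mult.assoc[symmetric])
      qed
    qed auto
  qed
qed

text \<open>Well-founded induction: if \<open>s\<close> and \<open>s'\<close> agree below
  \<open>i\<close>, both take at \<open>i\<close> the least remaining value of the common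
  range.\<close>

lemma strict_mono_range_eq:
  fixes s s' :: "'n::wellorder \<Rightarrow> real"
  assumes "strict_mono s" "strict_mono s'" "range s = range s'"
  shows "s = s'"
proof
  fix i show "s i = s' i"
  proof (induction i rule: less_induct)
    case (less i)
    have le: "z' i \<le> z i" if z: "strict_mono z" "strict_mono z'" "range z = range z'"
      "\<And>j. j < i \<Longrightarrow> z j = z' j" for z z' :: "'n \<Rightarrow> real"
    proof -
      obtain k where k: "z i = z' k" using z(3) by (metis rangeE rangeI)
      have "\<not> k < i" using z(4)[of k] k strict_mono_less[OF z(1), of k i] by auto
      then show ?thesis using k strict_mono_less_eq[OF z(2), of i k] by auto
    qed
    show ?case using le[of s s'] le[of s' s] less assms by force
  qed
qed

section \<open>Parametrization by switching times\<close>

text \<open>A switch of \<open>s\<close> that is not a switch of \<open>s'\<close> would be a simple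
  zero of the product, where it changes sign.\<close>

lemma node_product_sign_change:
  fixes s s' :: "real ^ 'n::{finite,wellorder}"
  assumes s: "s \<in> switch_simplex t"
    and nn: "\<And>x. 0 < x \<Longrightarrow> x < t \<Longrightarrow> 0 \<le> (\<Prod>l\<in>UNIV. x - s $ l) * (\<Prod>l\<in>UNIV. x - s' $ l)"
  shows "range (($) s) \<subseteq> range (($) s')"
proof (rule ccontr)
  assume "\<not> ?thesis"
  then obtain i where i: "s $ i \<notin> range (($) s')" by auto
  define g where "g x = (\<Prod>l\<in>UNIV-{i}. x - s $ l) * (\<Prod>l\<in>UNIV. x - s' $ l)" for x
  have pg: "(\<Prod>l\<in>UNIV. x - s $ l) * (\<Prod>l\<in>UNIV. x - s' $ l) = (x - s $ i) * g x" for x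
    unfolding g_def by (subst prod.remove[of UNIV i]) auto
  have inj: "s $ i \<noteq> s $ l" if "l \<noteq> i" for l
    using s that unfolding switch_simplex_def by (metis (mono_tags, lifting) less_irrefl mem_Collect_eq neqE)
  have g0: "g (s $ i) \<noteq> 0"
    unfolding g_def using i inj by (auto simp: image_iff)
  have "isCont g (s $ i)"
    unfolding g_def by (intro continuous_intros)
  then have "\<forall>\<^sub>F x in at (s $ i). sgn (g x) = sgn (g (s $ i))"
  proof -
    assume c: "isCont g (s $ i)"
    show ?thesis
    proof (cases "g (s $ i) > 0")
      case True
      then show ?thesis
        using order_tendstoD(1)[OF c[unfolded isCont_def] True] by (auto elim: eventually_mono)
    next
      case False
      then have "g (s $ i) < 0" using g0 by simp
      then show ?thesis
        using order_tendstoD(2)[OF c[unfolded isCont_def] \<open>g (s $ i) < 0\<close>] by (auto elim: eventually_mono)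
    qed
  qed
  then obtain e where e: "e > 0" "\<And>x. x \<noteq> s $ i \<Longrightarrow> \<bar>x - s $ i\<bar> < e \<Longrightarrow> sgn (g x) = sgn (g (s $ i))"
    unfolding eventually_at by (auto simp: dist_real_def)
  have si: "0 < s $ i" "s $ i < t" using s unfolding switch_simplex_def by auto
  \<comment> \<open>Both points \<open>s $ i + h\<close> and \<open>s $ i - h\<close> stay in the
    open interval and in the neighbourhood where \<open>g\<close> keeps its sign.\<close>
  define h where "h = Min {e, s $ i, t - s $ i} / 2"
  have h: "0 < h" "h < e" "h < s $ i" "h < t - s $ i"
    unfolding h_def using e(1) si by auto
  have "0 \<le> h * g (s $ i + h)" "0 \<le> - h * g (s $ i - h)"
    using nn[of "s $ i + h"] nn[of "s $ i - h"] h si by (auto simp: pg)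
  then have "0 \<le> g (s $ i + h)" "g (s $ i - h) \<le> 0"
    using h(1) by (auto simp: zero_le_mult_iff mult_le_0_iff)
  moreover have "sgn (g (s $ i + h)) = sgn (g (s $ i))" "sgn (g (s $ i - h)) = sgn (g (s $ i))"
    using e(2)[of "s $ i + h"] e(2)[of "s $ i - h"] h by auto
  ultimately show False using g0
    by (auto simp: sgn_if split: if_splits)
qed

text \<open>If two switching vectors give the same moments, then the difference of the controls is
  orthogonal to \<open>p - p'\<close>, where \<open>p\<close> and \<open>p'\<close> are the monic polynomials with the switches as
  roots, because \<open>p - p'\<close> has degree less than \<open>d\<close>. The integrand is nonnegative, hence zero,
  and therefore \<open>p\<close> and \<open>p'\<close> have the same sign almost everywhere.\<close>

lemma inj_on_bang_bang_moments:
  assumes \<mu>: "\<mu> > 0"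
  shows "inj_on (\<lambda>s. moment_map t (bang_bang \<mu> s) :: real ^ 'n::{finite,wellorder})
    (switch_simplex t :: (real ^ 'n::_) set)"
proof (rule inj_onI)
  fix s s' :: "(real, 'n) vec"
  assume s: "s \<in> switch_simplex t" and s': "s' \<in> switch_simplex t"
    and eq: "(moment_map t (bang_bang \<mu> s) :: (real, 'n) vec) = moment_map t (bang_bang \<mu> s')"
  define p where "p z x = (\<Prod>l\<in>UNIV. x - z $ l)" for z :: "(real, 'n) vec" and x
  define u where "u z x = bang_bang \<mu> z x" for z :: "(real, 'n) vec" and x
  have u: "u z x = \<mu> * sgn (p z x)" for z x by (simp add: u_def p_def bang_bang_def)
  have cp: "continuous_on UNIV (p z)" for z unfolding p_def by (intro continuous_intros)
  have adm: "admissible_control \<mu> t (u z)" for z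
    using admissible_bang_bang[of \<mu> t z] \<mu> unfolding u_def by simp
  obtain a :: "(real, 'n) vec" where a: "\<And>x. kernel_comb t a x = p s x - p s' x"
    unfolding p_def using kernel_comb_nodes_diff[of t s s'] by metis
  define h where "h x = (p s x - p s' x) * u s x - (p s x - p s' x) * u s' x" for x
  have "a \<bullet> moment_map t (u s) = a \<bullet> moment_map t (u s')"
    using eq by (simp add: u_def[abs_def])
  then have ieq: "integral {0..t} (\<lambda>x. kernel_comb t a x * u s x) = integral {0..t} (\<lambda>x. kernel_comb t a x * u s' x)"
    by (simp only: inner_moment_map[OF adm])
  have hi: "((\<lambda>x. (p s x - p s' x) * u z x) has_integral
      integral {0..t} (\<lambda>x. kernel_comb t a x * u z x)) {0..t}" for z
    unfolding a[symmetric] by (rule integrable_integral[OF kernel_comb_times_control_integrable[OF adm]])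
  have h_int: "(h has_integral 0) {0..t}"
    using has_integral_diff[OF hi[of s] hi[of s']] unfolding h_def[abs_def] ieq by simp
  have h_nn: "h x \<ge> 0" for x
  proof -
    \<comment> \<open>With \<open>y = p s x\<close> and \<open>z = p s' x\<close>: the sign function
      is monotone, so (y - z)(sgn y - sgn z) is nonnegative.\<close>
    have "(y - z) * (\<mu> * sgn y) - (y - z) * (\<mu> * sgn z) = \<mu> * ((\<bar>y\<bar> - y * sgn z) + (\<bar>z\<bar> - z * sgn y))" for y z :: real
      by (simp add: algebra_simps abs_sgn)
    moreover have "z * sgn y \<le> \<bar>z\<bar>" for y z :: real
      by (auto simp: sgn_if)
    then have "0 \<le> \<mu> * ((\<bar>y\<bar> - y * sgn z) + (\<bar>z\<bar> - z * sgn y))" for y z :: real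
      using \<mu> by (intro mult_nonneg_nonneg add_nonneg_nonneg) auto
    ultimately show ?thesis unfolding h_def u by simp
  qed
  have "0 \<le> p s x * p s' x" if x: "0 < x" "x < t" for x
  proof (rule ccontr)
    define U where "U = {0<..<t} \<inter> {y. p s y * p s' y < 0}"
    assume "\<not> ?thesis"
    then have xU: "x \<in> U" using x by (simp add: U_def)
    have "open U"
      unfolding U_def by (intro open_Int open_Collect_less continuous_intros cp)
    then obtain c d where cd: "x \<in> box c d" "cbox c d \<subseteq> U"
      using xU open_contains_cbox[of U x] by metis
    have sub: "cbox c d \<subseteq> {0..t}" using cd(2) by (auto simp: U_def)
    \<comment> \<open>The function \<open>h\<close> may jump at the switches. Where the two signs
      are opposite it equals a continuous function, so on a box inside \<open>U\<close> a vanishing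
      integral forces \<open>h\<close> to vanish pointwise.\<close>
    have hU: "h y = 2 * \<mu> * \<bar>p s y - p s' y\<bar>" if "y \<in> U" for y
    proof -
      have "p s y < 0 \<and> p s' y > 0 \<or> p s y > 0 \<and> p s' y < 0"
        using that by (auto simp: U_def mult_less_0_iff)
      then show ?thesis by (elim disjE) (auto simp: h_def u algebra_simps)
    qed
    have "continuous_on (cbox c d) (\<lambda>y. 2 * \<mu> * \<bar>p s y - p s' y\<bar>)"
      by (intro continuous_intros continuous_on_subset[OF cp]) auto
    then have cont: "continuous_on (cbox c d) h"
      by (rule continuous_on_eq) (use hU cd(2) in auto)
    have hi: "h integrable_on cbox c d"
      by (rule integrable_continuous[OF cont])
    have "integral (cbox c d) h \<le> integral {0..t} h"
      using h_int h_nn by (intro integral_subset_le sub hi) auto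
    moreover have "integral (cbox c d) h \<ge> 0"
      by (intro Henstock_Kurzweil_Integration.integral_nonneg hi h_nn)
    ultimately have "integral (cbox c d) h = 0"
      using integral_unique[OF h_int] by simp
    then have "(h has_integral 0) (cbox c d)"
      using hi by (metis integrable_integral)
    then have "h x = 0"
      using has_integral_0_cbox_imp_0[OF cont h_nn] cd(1) box_subset_cbox by blast
    then have "p s x = p s' x" using hU[OF xU] \<mu> by simp
    then show False using xU by (auto simp: U_def mult_less_0_iff)
  qed
  then have "range (($) s) \<subseteq> range (($) s')" "range (($) s') \<subseteq> range (($) s)"
    using node_product_sign_change[OF s, of s'] node_product_sign_change[OF s', of s]
    by (auto simp: p_def mult.commute)
  then have "($) s = ($) s'"
    using s s' by (intro strict_mono_range_eq) (auto simp: strict_mono_def switch_simplex_def)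
  then show "s = s'" by (simp add: vec_eq_iff)
qed

section \<open>Moments of a bang-bang control in closed form\<close>

definition kernel_primitive :: "real \<Rightarrow> nat \<Rightarrow> real \<Rightarrow> real" where
  "kernel_primitive t e x = (t ^ Suc e - (t - x) ^ Suc e) / fact (Suc e)"

lemma kernel_primitive_deriv:
  "(kernel_primitive t e has_real_derivative duhamel_kernel t e x) (at x within S)"
  unfolding kernel_primitive_def duhamel_kernel_def
  by (auto intro!: derivative_eq_intros simp del: power_Suc simp: divide_simps)

lemma kernel_has_integral:
  assumes "0 \<le> x"
  shows "(duhamel_kernel t e has_integral kernel_primitive t e x) {0..x}"
  using fundamental_theorem_of_calculus[OF assms, of "kernel_primitive t e" "duhamel_kernel t e"]
    kernel_primitive_deriv[of t e _ "{0..x}"]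
  by (auto simp: has_real_derivative_iff_has_vector_derivative[symmetric])
     (simp add: kernel_primitive_def)

text \<open>The closed form of the moments of \<open>bang_bang \<mu> s\<close> for ordered
  \<open>s\<close>: the control is \<mu> after the last switch, and going back past each switch adds
  a jump of alternating sign, the first one being -2 \<mu>. The formula is polynomial in
  \<open>s\<close> on the whole space, which gives continuity and the derivative at once.\<close>

definition switch_map :: "real \<Rightarrow> real \<Rightarrow> real ^ 'n::{finite,wellorder} \<Rightarrow> real ^ 'n::_" where
  "switch_map \<mu> t s = (\<chi> i. \<mu> * (kernel_primitive t (num_above i) t +
     2 * (\<Sum>l\<in>UNIV. (-1) ^ Suc (num_above l) * kernel_primitive t (num_above i) (s $ l))))"

text \<open>An up-closed set with m elements consists of the indices with \<open>num_above\<close>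
  from 0 to m - 1, so the left side is 1 - 2 + 2 - ... with m alternating terms. The induction
  removes the least element, which has all others above it.\<close>

lemma alternating_sum_up_set:
  fixes R :: "'n::{finite,wellorder} set"
  assumes "\<And>i j. i \<in> R \<Longrightarrow> i < j \<Longrightarrow> j \<in> R"
  shows "1 + 2 * (\<Sum>l\<in>R. (-1) ^ Suc (num_above l)) = (-1 :: real) ^ card R"
  using assms
proof (induction "card R" arbitrary: R)
  case 0
  then show ?case by simp
next
  case (Suc m)
  then have ne: "R \<noteq> {}" by auto
  define r where "r = Min R"
  have r: "r \<in> R" "\<And>j. j \<in> R \<Longrightarrow> r \<le> j" using ne by (auto simp: r_def)
  have "{j. r < j} = R - {r}"
    using r Suc.prems by (auto simp: order.order_iff_strict)
  then have ab: "num_above r = m" using Suc.hyps(2) r(1) by (simp add: num_above_def)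
  have c: "m = card (R - {r})" using Suc.hyps(2) r(1) by simp
  have "1 + 2 * (\<Sum>l\<in>R-{r}. (-1) ^ Suc (num_above l)) = (-1 :: real) ^ card (R - {r})"
  proof (rule Suc.hyps(1)[OF c])
    fix i j assume "i \<in> R - {r}" "i < j"
    then show "j \<in> R - {r}" using Suc.prems r(2)[of i] by auto
  qed
  moreover have "(\<Sum>l\<in>R. (-1) ^ Suc (num_above l)) = (-1 :: real) ^ Suc (num_above r) + (\<Sum>l\<in>R-{r}. (-1) ^ Suc (num_above l))"
    using r(1) by (intro sum.remove) auto
  ultimately show ?case
    using ab c Suc.hyps(2)[symmetric] by (simp add: algebra_simps)
qed

text \<open>The sign of the node product counts the switches at or after \<open>x\<close>; since
  \<open>s\<close> is nondecreasing, their indices form an up-closed set. This writes the control as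
  a sum of step functions, which integrates termwise.\<close>

lemma bang_bang_eq_sum:
  fixes s :: "real ^ 'n::{finite,wellorder}"
  assumes s: "s \<in> closed_switch_simplex t" and x: "x \<notin> range (($) s)"
  shows "bang_bang \<mu> s x = \<mu> * (1 + 2 * (\<Sum>l\<in>UNIV. (-1) ^ Suc (num_above l) * of_bool (x \<le> s $ l)))"
proof -
  define R where "R = {l. x \<le> s $ l}"
  have "sgn (\<Prod>l\<in>UNIV. x - s $ l) = (\<Prod>l\<in>UNIV. sgn (x - s $ l))"
    by (induction rule: infinite_finite_induct) (auto simp: sgn_mult)
  also have "\<dots> = (\<Prod>l\<in>UNIV. if l \<in> R then -1 else 1)"
    using x by (intro prod.cong) (auto simp: R_def sgn_if image_iff)
  also have "\<dots> = (\<Prod>l\<in>R. -1)"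
    by (simp add: prod.If_cases)
  also have "\<dots> = (-1) ^ card R" by simp
  also have "\<dots> = 1 + 2 * (\<Sum>l\<in>R. (-1) ^ Suc (num_above l))"
    using s by (intro alternating_sum_up_set[symmetric])
      (auto simp: R_def closed_switch_simplex_def intro: order_trans)
  also have "(\<Sum>l\<in>R. (-1) ^ Suc (num_above l)) = (\<Sum>l\<in>UNIV. (-1) ^ Suc (num_above l) * of_bool (x \<le> s $ l) :: real)"
    unfolding R_def by (intro sum.mono_neutral_cong_left) auto
  finally show ?thesis unfolding bang_bang_def by simp
qed

lemma moment_map_bang_bang:
  fixes s :: "real ^ 'n::{finite,wellorder}"
  assumes s: "s \<in> closed_switch_simplex t"
  shows "moment_map t (bang_bang \<mu> s) = switch_map \<mu> t s"
proof -
  have "((\<lambda>x. duhamel_kernel t e x * bang_bang \<mu> s x) has_integral \<mu> * (kernel_primitive t e t +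
     2 * (\<Sum>l\<in>UNIV. (-1) ^ Suc (num_above l) * kernel_primitive t e (s $ l)))) {0..t}" for e
  proof -
    have b: "0 \<le> s $ l" "s $ l \<le> t" for l
      using s unfolding closed_switch_simplex_def by auto
    have "((\<lambda>x. if x \<in> {0..s $ l} then duhamel_kernel t e x else 0) has_integral kernel_primitive t e (s $ l)) {0..t}" for l
      using kernel_has_integral[OF b(1)[of l]] b by (subst has_integral_restrict) auto
    then have "((\<lambda>x. \<mu> * (duhamel_kernel t e x + 2 * (\<Sum>l\<in>UNIV. (-1) ^ Suc (num_above l) * (if x \<in> {0..s $ l} then duhamel_kernel t e x else 0))))
       has_integral \<mu> * (kernel_primitive t e t +
       2 * (\<Sum>l\<in>UNIV. (-1) ^ Suc (num_above l) * kernel_primitive t e (s $ l)))) {0..t}"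
      by (intro has_integral_mult_right has_integral_add has_integral_sum kernel_has_integral
          order_trans[OF b]) auto
    then show ?thesis
    proof (rule has_integral_spike_finite[rotated 2])
      fix x assume x: "x \<in> {0..t} - range (($) s)"
      have "duhamel_kernel t e x * (\<Sum>l\<in>UNIV. (-1) ^ Suc (num_above l) * of_bool (x \<le> s $ l)) =
          (\<Sum>l\<in>UNIV. (-1) ^ Suc (num_above l) * (if x \<in> {0..s $ l} then duhamel_kernel t e x else 0))"
        unfolding sum_distrib_left using x by (intro sum.cong) auto
      moreover have "bang_bang \<mu> s x = \<mu> * (1 + 2 * (\<Sum>l\<in>UNIV. (-1) ^ Suc (num_above l) * of_bool (x \<le> s $ l)))"
        using x by (intro bang_bang_eq_sum[OF s]) auto
      ultimately show "duhamel_kernel t e x * bang_bang \<mu> s x = \<mu> * (duhamel_kernel t e x + 2 * (\<Sum>l\<in>UNIV. (-1) ^ Suc (num_above l) * (if x \<in> {0..s $ l} then duhamel_kernel t e x else 0)))"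
        by (simp add: algebra_simps)
    qed auto
  qed
  then show ?thesis
    by (simp add: vec_eq_iff moment_map_def switch_map_def integral_unique)
qed

lemma inj_on_switch_map:
  assumes "\<mu> > 0"
  shows "inj_on (switch_map \<mu> t) (switch_simplex t :: (real ^ 'n::{finite,wellorder}) set)"
proof -
  have "switch_map \<mu> t s = moment_map t (bang_bang \<mu> s)" if "s \<in> switch_simplex t" for s :: "(real, 'n) vec"
    using moment_map_bang_bang[of s t \<mu>] that switch_simplex_subset[of t] by auto
  then show ?thesis
    using inj_on_bang_bang_moments[OF assms, of t]
    by (subst inj_on_cong[of _ _ "\<lambda>s. moment_map t (bang_bang \<mu> s)"]) auto
qed

lemma continuous_on_switch_map: "continuous_on S (switch_map \<mu> t)"
  unfolding switch_map_def[abs_def] kernel_primitive_def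
  by (intro continuous_intros) auto

text \<open>The image of the open simplex is open by invariance of domain and relatively closed in the
  interior of the reach set because faces are mapped to the boundary.\<close>

lemma switch_map_image:
  assumes \<mu>: "\<mu> > 0" and t: "t > 0"
  shows "switch_map \<mu> t ` (switch_simplex t :: (real ^ 'n::{finite,wellorder}) set) =
    interior (reach_kernel_set \<mu> t)"
proof -
  let ?S = "switch_simplex t :: (real, 'n) vec set"
  let ?T = "closed_switch_simplex t :: (real, 'n) vec set"
  let ?I = "interior (reach_kernel_set \<mu> t) :: (real, 'n) vec set"
  let ?U = "switch_map \<mu> t ` ?S"
  have mm: "switch_map \<mu> t s = moment_map t (bang_bang \<mu> s)" if "s \<in> ?T" for s
    using moment_map_bang_bang[OF that] by simp
  have sub: "?U \<subseteq> reach_kernel_set \<mu> t"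
    using mm switch_simplex_subset[of t] admissible_bang_bang[of \<mu> t] \<mu>
    unfolding reach_kernel_set_def by fastforce
  have oU: "open ?U"
    by (rule invariance_of_domain[OF continuous_on_switch_map open_switch_simplex inj_on_switch_map[OF \<mu>]])
  have UI: "?U \<subseteq> ?I" by (rule interior_maximal[OF sub oU])
  have "?U = switch_map \<mu> t ` ?T \<inter> ?I"
  proof (intro subset_antisym)
    show "?U \<subseteq> switch_map \<mu> t ` ?T \<inter> ?I"
      using UI switch_simplex_subset[of t] by blast
    show "switch_map \<mu> t ` ?T \<inter> ?I \<subseteq> ?U"
      using bang_bang_boundary_not_interior[of \<mu> _ t] mm \<mu> by fastforce
  qed
  moreover have "closed (switch_map \<mu> t ` ?T)"
    by (intro compact_imp_closed compact_continuous_image continuous_on_switch_map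
        compact_closed_switch_simplex)
  ultimately have "closedin (top_of_set ?I) ?U"
    by (metis closedin_closed_Int inf_commute)
  moreover have "openin (top_of_set ?I) ?U"
    using oU UI by (simp add: openin_open_eq)
  moreover have "connected ?I"
    by (intro convex_connected convex_interior convex_reach_kernel_set)
  ultimately show ?thesis
    using nonempty_switch_simplex[OF t, where 'n='n] unfolding connected_clopen by fastforce
qed

section \<open>The Jacobian determinant and the volume\<close>

text \<open>The number of factors of the Vandermonde product, that is, its degree of
  homogeneity.\<close>

lemma card_greater_pairs_sum: "card {(i, l). i < (l :: 'n::{finite,wellorder})} = (\<Sum>e<CARD('n). e)"
proof -
  have "{(i, l). i < (l :: 'n)} = Sigma UNIV (\<lambda>i. {l. i < l})" by auto
  then have "card {(i, l). i < (l :: 'n)} = (\<Sum>i\<in>(UNIV :: 'n set). num_above i)"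
    by (simp add: num_above_def)
  also have "\<dots> = (\<Sum>e<CARD('n). e)"
    by (rule sum.reindex_bij_betw[OF bij_betw_above])
  finally show ?thesis .
qed

text \<open>Multiplication from the left by the matrix of coefficients of the Newton polynomials
  turns the Vandermonde matrix into a triangular one.\<close>

lemma det_vandermonde:
  fixes y :: "real ^ 'n::{finite,wellorder}"
  shows "det ((\<chi> i j. y $ j ^ num_above i) :: ((real, 'n) vec, 'n) vec) = (\<Prod>(i, l)\<in>{(i, l). i < l}. y $ i - y $ l)"
proof -
  \<comment> \<open>The Newton polynomial with roots at the nodes after \<open>i\<close>: monic of
    degree \<open>num_above i\<close>, so \<open>W\<close> is upper triangular with unit diagonal,
    and \<open>W ** V\<close>, whose entries are the values of \<open>r i\<close> at the nodes, is
    lower triangular.\<close>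
  define r where "r i = (\<Prod>l\<in>{l. i < l}. [:- (y $ l), 1:])" for i
  have deg: "degree (r i) = num_above i" for i
    unfolding r_def num_above_def by (subst degree_prod_sum_eq) auto
  have lc: "coeff (r i) (num_above i) = 1" for i
    using lead_coeff_prod[of "\<lambda>l. [:- (y $ l), 1:]" "{l. i < l}"] unfolding r_def[symmetric] deg by simp
  define W where "W = ((\<chi> i k. coeff (r i) (num_above k)) :: ((real, 'n) vec, 'n) vec)"
  define V where "V = ((\<chi> i j. y $ j ^ num_above i) :: ((real, 'n) vec, 'n) vec)"
  have WV: "(W ** V) $ i $ j = (\<Prod>l\<in>{l. i < l}. y $ j - y $ l)" for i j
  proof -
    have "(W ** V) $ i $ j = (\<Sum>k\<in>(UNIV::'n set). coeff (r i) (num_above k) * y $ j ^ num_above k)"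
      by (simp add: W_def V_def matrix_matrix_mult_def)
    also have "\<dots> = (\<Sum>e<CARD('n). coeff (r i) e * y $ j ^ e)"
      by (rule sum.reindex_bij_betw[OF bij_betw_above])
    also have "\<dots> = (\<Sum>e\<le>degree (r i). coeff (r i) e * y $ j ^ e)"
      using above_less_card[of i] by (intro sum.mono_neutral_right) (auto simp: deg coeff_eq_0)
    also have "\<dots> = poly (r i) (y $ j)" by (simp add: poly_altdef)
    finally show ?thesis by (simp add: r_def poly_prod)
  qed
  have "det W = (\<Prod>i\<in>UNIV. W $ i $ i)"
  proof (rule det_upperdiagonal)
    fix i j :: 'n assume "j < i"
    then have "num_above i < num_above j" by (rule above_strict_antimono)
    then show "W $ i $ j = 0" by (simp add: W_def coeff_eq_0 deg)
  qed
  then have "det W = 1" by (simp add: W_def lc)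
  then have "det V = det (W ** V)" by (simp add: det_mul)
  also have "\<dots> = (\<Prod>i\<in>UNIV. (W ** V) $ i $ i)"
    by (rule det_lowerdiagonal) (auto simp: WV)
  also have "\<dots> = (\<Prod>i\<in>UNIV. \<Prod>l\<in>{l. i < l}. y $ i - y $ l)" by (simp add: WV)
  also have "\<dots> = (\<Prod>(i, l)\<in>Sigma UNIV (\<lambda>i. {l. i < l}). y $ i - y $ l)"
    by (rule prod.Sigma) auto
  also have "Sigma UNIV (\<lambda>i. {l. i < l}) = {(i, l). i < (l :: 'n)}" by auto
  finally show ?thesis unfolding V_def .
qed

definition switch_jacobian :: "real \<Rightarrow> real \<Rightarrow> real ^ 'n::{finite,wellorder} \<Rightarrow> real ^ 'n::_ ^ 'n::_" where
  "switch_jacobian \<mu> t s = (\<chi> i l. 2 * \<mu> * (-1) ^ Suc (num_above l) * duhamel_kernel t (num_above i) (s $ l))"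

lemma switch_map_has_derivative:
  fixes s :: "real ^ 'n::{finite,wellorder}"
  shows "(switch_map \<mu> t has_derivative (\<lambda>h. switch_jacobian \<mu> t s *v h)) (at s within S)"
proof -
  have "((\<lambda>s. kernel_primitive t e (s $ l)) has_derivative (\<lambda>h. h $ l * duhamel_kernel t e (s $ l))) (at s within S)" for e l
  proof -
    have 1: "(kernel_primitive t e has_derivative (*) (duhamel_kernel t e (s $ l))) (at (s $ l) within UNIV)"
      using kernel_primitive_deriv[of t e "s $ l" UNIV] by (simp only: has_field_derivative_def)
    have 2: "((\<lambda>s. s $ l) has_derivative (\<lambda>h. h $ l)) (at s within S)"
      by (rule bounded_linear_imp_has_derivative[OF bounded_linear_vec_nth])
    show ?thesis
      using has_derivative_compose[OF 2 1] by (simp add: mult.commute)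
  qed
  then have "((\<lambda>s. switch_map \<mu> t s $ i) has_derivative
      (\<lambda>h. \<mu> * (0 + 2 * (\<Sum>l\<in>UNIV. (-1) ^ Suc (num_above l) * (h $ l * duhamel_kernel t (num_above i) (s $ l))))))
      (at s within S)" for i
    unfolding switch_map_def vec_lambda_beta
    by (intro has_derivative_mult_right has_derivative_add has_derivative_sum has_derivative_const)
  moreover have "\<mu> * (0 + 2 * (\<Sum>l\<in>UNIV. (-1) ^ Suc (num_above l) * (h $ l * duhamel_kernel t (num_above i) (s $ l)))) =
      (switch_jacobian \<mu> t s *v h) $ i" for i h
    by (simp add: switch_jacobian_def matrix_vector_mult_def sum_distrib_left mult_ac)
  ultimately have "((\<lambda>s. switch_map \<mu> t s $ i) has_derivative (\<lambda>h. (switch_jacobian \<mu> t s *v h) $ i))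
      (at s within S)" for i
    by simp
  then show ?thesis
    by (subst has_derivative_componentwise_within)
      (auto simp: Basis_vec_def cart_eq_inner_axis[symmetric])
qed

lemma abs_det_switch_jacobian:
  fixes s :: "real ^ 'n::{finite,wellorder}"
  assumes "\<mu> > 0"
  shows "\<bar>det (switch_jacobian \<mu> t s)\<bar> = (2 * \<mu>) ^ CARD('n) / (\<Prod>k=1..CARD('n)-1. fact k) *
    (\<Prod>(i, l)\<in>{(i, l). i < l}. \<bar>s $ l - s $ i\<bar>)"
proof -
  \<comment> \<open>Row factors from the jump size and the kernel denominators, column factors from
    the alternating signs; what remains is the Vandermonde matrix of the nodes
    \<open>t - s $ l\<close>.\<close>
  define R where "R = ((\<chi> i j. if i = j then 2 * \<mu> / fact (num_above i) else 0) :: ((real, 'n) vec, 'n) vec)"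
  define C where "C = ((\<chi> i j. if i = j then (-1) ^ Suc (num_above i) else 0) :: ((real, 'n) vec, 'n) vec)"
  define V where "V = ((\<chi> i j. (\<chi> l. t - s $ l) $ j ^ num_above i) :: ((real, 'n) vec, 'n) vec)"
  have "switch_jacobian \<mu> t s = R ** V ** C"
    unfolding vec_eq_iff
  proof (intro allI)
    fix i j
    have "(R ** V) $ i $ k = 2 * \<mu> / fact (num_above i) * (t - s $ k) ^ num_above i" for k
      by (simp add: R_def V_def matrix_matrix_mult_def if_distrib[of "\<lambda>x. x * _"] cong: if_cong)
    then show "switch_jacobian \<mu> t s $ i $ j = (R ** V ** C) $ i $ j"
      by (simp add: matrix_matrix_mult_def[of "R ** V"] C_def switch_jacobian_def duhamel_kernel_def
          if_distrib[of "\<lambda>x. _ * x"] cong: if_cong)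
  qed
  then have "\<bar>det (switch_jacobian \<mu> t s)\<bar> = \<bar>det R\<bar> * \<bar>det V\<bar> * \<bar>det C\<bar>"
    by (simp add: det_mul abs_mult)
  moreover have "det R = (2 * \<mu>) ^ CARD('n) / (\<Prod>k=1..CARD('n)-1. fact k)"
  proof -
    have "det R = (\<Prod>i\<in>UNIV. R $ i $ i)" by (rule det_diagonal) (simp add: R_def)
    also have "\<dots> = (2 * \<mu>) ^ CARD('n) / (\<Prod>i\<in>(UNIV::'n set). fact (num_above i))"
      by (simp add: R_def prod_dividef)
    also have "(\<Prod>i\<in>(UNIV::'n set). fact (num_above i)) = (\<Prod>e<CARD('n). fact e :: real)"
      by (rule prod.reindex_bij_betw[OF bij_betw_above])
    also have "\<dots> = (\<Prod>k=1..CARD('n)-1. fact k)"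
      by (rule prod.mono_neutral_cong_right) (auto simp: less_Suc_eq_le Suc_le_eq)
    finally show ?thesis .
  qed
  moreover have "\<bar>det C\<bar> = 1"
  proof -
    have "det C = (\<Prod>i\<in>UNIV. C $ i $ i)" by (rule det_diagonal) (simp add: C_def)
    then show ?thesis by (simp add: C_def abs_prod abs_mult power_abs)
  qed
  moreover have "\<bar>det V\<bar> = (\<Prod>(i, l)\<in>{(i, l). i < l}. \<bar>s $ l - s $ i\<bar>)"
    unfolding V_def det_vandermonde by (simp add: abs_prod case_prod_beta)
  moreover have "(2 * \<mu>) ^ CARD('n) / (\<Prod>k=1..CARD('n)-1. fact k) \<ge> 0"
    using assms by (intro divide_nonneg_nonneg prod_nonneg) auto
  ultimately show ?thesis by (simp only: abs_of_nonneg mult_1_right)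
qed

section \<open>Reduction to an integral over a cube\<close>

text \<open>Truncating each factor extends the Vandermonde product continuously by zero beyond the
  increasing vectors.\<close>

definition ordered_vandermonde :: "real ^ 'n::{finite,wellorder} \<Rightarrow> real" where
  "ordered_vandermonde s = (\<Prod>(i, l)\<in>{(i, l). i < l}. max 0 (s $ l - s $ i))"

lemma continuous_on_ordered_vandermonde: "continuous_on S ordered_vandermonde"
  unfolding ordered_vandermonde_def[abs_def] case_prod_beta by (intro continuous_intros)

lemma ordered_vandermonde_nonzero:
  assumes "ordered_vandermonde s \<noteq> 0" "i < j"
  shows "s $ i < s $ j"
proof -
  have "finite {(i, l). i < (l :: 'a)}" by simp
  then have "max 0 (s $ j - s $ i) \<noteq> 0"
    using assms unfolding ordered_vandermonde_def prod_zero_iff by fastforce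
  then show ?thesis by (simp add: max_def split: if_splits)
qed

lemma ordered_vandermonde_switch_simplex:
  assumes "s \<in> switch_simplex t"
  shows "ordered_vandermonde s = (\<Prod>(i, l)\<in>{(i, l). i < l}. \<bar>s $ l - s $ i\<bar>)"
  unfolding ordered_vandermonde_def
proof (rule prod.cong)
  show "(case p of (i, l) \<Rightarrow> max 0 (s $ l - s $ i)) = (case p of (i, l) \<Rightarrow> \<bar>s $ l - s $ i\<bar>)"
    if p: "p \<in> {(i, l). i < l}" for p
  proof -
    have "s $ fst p < s $ snd p" using assms p by (auto simp: switch_simplex_def)
    then show ?thesis by (simp add: case_prod_beta)
  qed
qed simp

text \<open>A point of the cube with nonzero integrand has increasing coordinates, so it misses the
  simplex only if it lies on a face \<open>x $ i = 0\<close> or \<open>x $ i = t\<close>.\<close>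

lemma ordered_vandermonde_integral_simplex:
  fixes c :: real
  shows "(ordered_vandermonde has_integral c) (switch_simplex t :: (real ^ 'n::{finite,wellorder}) set)
    \<longleftrightarrow> (ordered_vandermonde has_integral c) (cbox 0 (\<chi> i. t) :: (real ^ 'n::_) set)"
proof (rule has_integral_spike_set_eq)
  have "{x \<in> switch_simplex t - cbox 0 (\<chi> i. t). ordered_vandermonde x \<noteq> 0} = ({} :: (real, 'n) vec set)"
    by (auto simp: switch_simplex_def mem_box_cart intro: less_imp_le)
  then show "negligible {x \<in> switch_simplex t - (cbox 0 (\<chi> i. t) :: (real, 'n) vec set). ordered_vandermonde x \<noteq> 0}"
    by (simp only: negligible_empty)
  have "{x \<in> cbox 0 (\<chi> i. t) - switch_simplex t. ordered_vandermonde x \<noteq> 0} \<subseteq>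
      (\<Union>i. {x :: (real, 'n) vec. x $ i = 0}) \<union> (\<Union>i. {x. x $ i = t})"
    using ordered_vandermonde_nonzero
    by (auto simp: switch_simplex_def mem_box_cart order_less_le[where 'a=real])
  moreover have "negligible ((\<Union>i. {x :: (real, 'n) vec. x $ i = 0}) \<union> (\<Union>i. {x. x $ i = t}))"
    unfolding cart_eq_inner_axis
    by (intro negligible_Un negligible_Union) (auto simp: negligible_standard_hyperplane axis_in_Basis_iff)
  ultimately show "negligible {x \<in> (cbox 0 (\<chi> i. t) :: (real, 'n) vec set) - switch_simplex t. ordered_vandermonde x \<noteq> 0}"
    by (rule negligible_subset[rotated])
qed

lemma measure_reach_kernel_set:
  assumes \<mu>: "\<mu> > 0" and t: "t > 0"
  shows "measure lebesgue (reach_kernel_set \<mu> t :: (real ^ 'n::{finite,wellorder}) set) =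
    (2 * \<mu>) ^ CARD('n) / (\<Prod>k=1..CARD('n)-1. fact k) *
    integral (cbox 0 (\<chi> i. t)) (ordered_vandermonde :: real ^ 'n::_ \<Rightarrow> real)"
proof -
  let ?M = "reach_kernel_set \<mu> t :: (real, 'n) vec set"
  let ?S = "switch_simplex t :: (real, 'n) vec set"
  let ?V = "ordered_vandermonde :: (real, 'n) vec \<Rightarrow> real"
  let ?c = "(2 * \<mu>) ^ CARD('n) / (\<Prod>k=1..CARD('n)-1. fact k) :: real"
  have "(?V has_integral integral (cbox 0 (\<chi> i. t)) ?V) (cbox 0 (\<chi> i. t))"
    by (intro integrable_integral integrable_continuous continuous_on_ordered_vandermonde)
  then have "((\<lambda>s. ?c * ?V s) has_integral ?c * integral (cbox 0 (\<chi> i. t)) ?V) ?S"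
    unfolding ordered_vandermonde_integral_simplex[symmetric] by (rule has_integral_mult_right)
  then have I: "((\<lambda>s. \<bar>det (matrix (\<lambda>h. switch_jacobian \<mu> t s *v h))\<bar>) has_integral
      ?c * integral (cbox 0 (\<chi> i. t)) ?V) ?S"
    by (rule has_integral_eq[rotated])
      (simp add: abs_det_switch_jacobian[OF \<mu>] ordered_vandermonde_switch_simplex)
  \<comment> \<open>The frontier of a convex set is a null set, so the parametrized interior carries
    the whole volume.\<close>
  have "measure lebesgue ?M = measure lebesgue (interior ?M)"
    by (rule measure_interior[symmetric, OF bounded_reach_kernel_set
          negligible_convex_frontier[OF convex_reach_kernel_set]])
  also have "interior ?M = switch_map \<mu> t ` ?S"
    by (rule switch_map_image[OF \<mu> t, symmetric])
  also have "measure lebesgue \<dots> = integral ?S (\<lambda>s. \<bar>det (matrix (\<lambda>h. switch_jacobian \<mu> t s *v h))\<bar>)"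
    using I open_switch_simplex[of t, where 'a='n]
    by (intro measure_differentiable_image_eq switch_map_has_derivative inj_on_switch_map \<mu>)
      (auto simp: has_integral_integrable)
  also have "\<dots> = ?c * integral (cbox 0 (\<chi> i. t)) ?V"
    by (rule integral_unique[OF I])
  finally show ?thesis .
qed

section \<open>Riemann sums\<close>

text \<open>Half-open, so that for positive \<delta> the cells partition the nonnegative orthant;
  the index of the cell of a point is then a componentwise floor.\<close>

definition grid_cell :: "real \<Rightarrow> ('n \<Rightarrow> nat) \<Rightarrow> (real ^ 'n) set" where
  "grid_cell \<delta> g = {x. \<forall>i. \<delta> * g i \<le> x $ i \<and> x $ i < \<delta> * (g i + 1)}"

lemma grid_cell_measurable: "grid_cell \<delta> g \<in> sets borel"
proof -
  have "grid_cell \<delta> g = (\<Inter>i. {x. \<delta> * g i \<le> x $ i}) \<inter> (\<Inter>i. {x. x $ i < \<delta> * (g i + 1)})"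
    unfolding grid_cell_def by auto
  also have "\<dots> \<in> sets borel"
    by (intro sets.Int borel_closed borel_open closed_INT open_INT ballI closed_Collect_le
        open_Collect_less continuous_intros) auto
  finally show ?thesis .
qed

lemma grid_cell_measure:
  fixes g :: "'n::finite \<Rightarrow> nat"
  assumes \<delta>: "\<delta> > 0"
  shows "measure lborel (grid_cell \<delta> g) = \<delta> ^ CARD('n)" "emeasure lborel (grid_cell \<delta> g) < \<infinity>"
proof -
  let ?a = "(\<chi> i. \<delta> * g i) :: (real, 'n) vec" and ?b = "(\<chi> i. \<delta> * (g i + 1)) :: (real, 'n) vec"
  have sub: "box ?a ?b \<subseteq> grid_cell \<delta> g" "grid_cell \<delta> g \<subseteq> cbox ?a ?b"
    unfolding grid_cell_def subset_iff mem_box_cart mem_Collect_eq vec_lambda_beta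
    by (meson less_imp_le)+
  have fin: "grid_cell \<delta> g \<in> fmeasurable lborel"
    by (rule fmeasurableI2[OF _ sub(2)]) (auto simp: grid_cell_measurable)
  then show "emeasure lborel (grid_cell \<delta> g) < \<infinity>" by (simp add: fmeasurable_def)
  have ab: "?a $ i \<le> ?b $ i" for i using \<delta> by (simp add: algebra_simps)
  then have ne: "cbox ?a ?b \<noteq> {}" by (simp add: interval_ne_empty_cart)
  have "measure lborel (cbox ?a ?b) = (\<Prod>i\<in>UNIV. ?b $ i - ?a $ i)"
    by (rule content_cbox_cart[OF ne])
  also have "\<dots> = \<delta> ^ CARD('n)" by (simp add: algebra_simps)
  finally have c: "measure lborel (cbox ?a ?b) = \<delta> ^ CARD('n)" .
  moreover have "measure lborel (box ?a ?b) = measure lborel (cbox ?a ?b)"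
    by (simp only: measure_lborel_box_eq measure_lborel_cbox_eq)
  moreover have "measure lborel (box ?a ?b) \<le> measure lborel (grid_cell \<delta> g)"
    by (rule measure_mono_fmeasurable[OF sub(1) _ fin]) simp
  moreover have "measure lborel (grid_cell \<delta> g) \<le> measure lborel (cbox ?a ?b)"
    by (rule measure_mono_fmeasurable[OF sub(2)]) (auto simp: grid_cell_measurable)
  ultimately show "measure lborel (grid_cell \<delta> g) = \<delta> ^ CARD('n)" by simp
qed

lemma grid_cell_iff:
  fixes x :: "real ^ 'n"
  assumes \<delta>: "\<delta> > 0"
  shows "x \<in> grid_cell \<delta> g \<longleftrightarrow> (\<forall>i. 0 \<le> x $ i) \<and> g = (\<lambda>i. nat \<lfloor>x $ i / \<delta>\<rfloor>)"
proof -
  have "\<delta> * g i \<le> x $ i \<and> x $ i < \<delta> * (g i + 1) \<longleftrightarrow> 0 \<le> x $ i \<and> g i = nat \<lfloor>x $ i / \<delta>\<rfloor>" for i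
  proof -
    have "\<delta> * g i \<le> x $ i \<and> x $ i < \<delta> * (g i + 1) \<longleftrightarrow> real (g i) \<le> x $ i / \<delta> \<and> x $ i / \<delta> < real (g i) + 1"
      using \<delta> by (simp add: field_simps)
    also have "\<dots> \<longleftrightarrow> \<lfloor>x $ i / \<delta>\<rfloor> = int (g i)"
      by (simp add: floor_eq_iff)
    also have "\<dots> \<longleftrightarrow> 0 \<le> \<lfloor>x $ i / \<delta>\<rfloor> \<and> g i = nat \<lfloor>x $ i / \<delta>\<rfloor>" by linarith
    also have "0 \<le> \<lfloor>x $ i / \<delta>\<rfloor> \<longleftrightarrow> 0 \<le> x $ i"
      using \<delta> by (simp add: zero_le_divide_iff)
    finally show ?thesis .
  qed
  then show ?thesis unfolding grid_cell_def by (auto simp: fun_eq_iff)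
qed

lemma finite_bounded_functions: "finite {g :: 'n::finite \<Rightarrow> nat. \<forall>i. g i \<le> n}"
proof -
  have "{g :: 'n \<Rightarrow> nat. \<forall>i. g i \<le> n} = PiE UNIV (\<lambda>_. {..n})" by auto
  then show ?thesis by (simp add: finite_PiE)
qed

text \<open>Dominated convergence for step functions that sample \<open>F\<close> at the lower
  corner of each cell. Each index runs up to \<open>n\<close> inclusive, so a layer of cells sticks
  out of the cube by one mesh width; it disappears in the pointwise limit.\<close>

lemma riemann_sum_cube:
  fixes F :: "real ^ 'n \<Rightarrow> real"
  assumes F: "continuous_on UNIV F" and t: "t > 0"
  shows "(\<lambda>n. (t / real n) ^ CARD('n) * (\<Sum>g | \<forall>i. g i \<le> n. F (\<chi> i. t / real n * real (g i))))
    \<longlonglongrightarrow> integral (cbox 0 (\<chi> i. t)) F"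
\<comment> \<open>The shift to \<open>Suc n\<close> keeps the mesh width positive.\<close>
proof (rule LIMSEQ_imp_Suc)
  define G where "G n = {g :: 'n \<Rightarrow> nat. \<forall>i. g i \<le> n}" for n
  have finG: "finite (G n)" for n unfolding G_def by (rule finite_bounded_functions)
  define \<delta> where "\<delta> n = t / Suc n" for n :: nat
  have \<delta>: "\<delta> n > 0" for n using t by (simp add: \<delta>_def)
  define h where "h n x = (\<Sum>g\<in>G (Suc n). F (\<chi> i. \<delta> n * g i) * indicator (grid_cell (\<delta> n) g) x)" for n x
  define g0 where "g0 n x = (\<lambda>i. nat \<lfloor>x $ i / \<delta> n\<rfloor>)" for n and x :: "(real, 'n) vec"
  have h_eq: "h n x = (if (\<forall>i. 0 \<le> x $ i) \<and> g0 n x \<in> G (Suc n) then F (\<chi> i. \<delta> n * g0 n x i) else 0)" for n x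
  proof -
    have "h n x = (\<Sum>g\<in>G (Suc n). if g = g0 n x then (if \<forall>i. 0 \<le> x $ i then F (\<chi> i. \<delta> n * g i) else 0) else 0)"
      unfolding h_def g0_def by (intro sum.cong) (auto simp: indicator_def grid_cell_iff[OF \<delta>])
    also have "\<dots> = (if (\<forall>i. 0 \<le> x $ i) \<and> g0 n x \<in> G (Suc n) then F (\<chi> i. \<delta> n * g0 n x i) else 0)"
      using finG by (subst sum.delta) auto
    finally show ?thesis .
  qed
  have int_h: "integral\<^sup>L lborel (h n) = \<delta> n ^ CARD('n) * (\<Sum>g\<in>G (Suc n). F (\<chi> i. \<delta> n * g i))" for n
  proof -
    have "integral\<^sup>L lborel (h n) = (\<Sum>g\<in>G (Suc n). F (\<chi> i. \<delta> n * g i) * measure lborel (grid_cell (\<delta> n) g))"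
      unfolding h_def[abs_def]
    proof (subst Bochner_Integration.integral_sum)
      show "integrable lborel (\<lambda>x. F (\<chi> i. \<delta> n * g i) * indicator (grid_cell (\<delta> n) g) x)" for g
        using grid_cell_measure(2)[OF \<delta>, of n g]
        by (intro integrable_mult_right integrable_real_indicator) (auto simp: grid_cell_measurable)
    qed simp
    then show ?thesis by (simp add: grid_cell_measure(1)[OF \<delta>] sum_distrib_left mult.commute)
  qed
  have floor_bounds: "\<delta> n * g0 n x i \<le> x $ i" "x $ i - \<delta> n \<le> \<delta> n * g0 n x i" if "0 \<le> x $ i" for n x i
  proof -
    have r: "real (g0 n x i) = of_int \<lfloor>x $ i / \<delta> n\<rfloor>"
      using that \<delta>[of n] by (simp add: g0_def)
    have "real (g0 n x i) \<le> x $ i / \<delta> n" "x $ i / \<delta> n \<le> real (g0 n x i) + 1"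
      unfolding r by linarith+
    then show "\<delta> n * g0 n x i \<le> x $ i" "x $ i - \<delta> n \<le> \<delta> n * g0 n x i"
      using \<delta>[of n] by (simp_all add: field_simps)
  qed
  \<comment> \<open>Every cell used lies in this cube: its lower corner is at most \<open>t\<close>
    in each coordinate and its width at most \<open>t\<close>.\<close>
  let ?K = "cbox 0 (\<chi> i. 2 * t) :: (real, 'n) vec set"
  have "compact (F ` ?K)"
    by (intro compact_continuous_image continuous_on_subset[OF F]) auto
  then obtain B where B: "\<And>x. x \<in> ?K \<Longrightarrow> \<bar>F x\<bar> \<le> B"
    by (metis bounded_iff compact_imp_bounded image_eqI real_norm_def)
  have "(\<lambda>n. integral\<^sup>L lborel (h n)) \<longlonglongrightarrow> integral\<^sup>L lborel (\<lambda>x. indicator (cbox 0 (\<chi> i. t)) x *\<^sub>R F x)"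
  proof (rule integral_dominated_convergence[where w="\<lambda>x. indicator ?K x *\<^sub>R B"])
    show "(\<lambda>x. indicator (cbox 0 (\<chi> i. t)) x *\<^sub>R F x) \<in> borel_measurable lborel"
      by (intro borel_measurable_integrable borel_integrable_compact continuous_on_subset[OF F]) auto
    show "integrable lborel (\<lambda>x. indicator ?K x *\<^sub>R B)"
      by (intro borel_integrable_compact) auto
    show "h n \<in> borel_measurable lborel" for n
      unfolding h_def[abs_def] using grid_cell_measurable by measurable
    show "AE x in lborel. norm (h n x) \<le> indicator ?K x *\<^sub>R B" for n
    proof (rule AE_I2)
      fix x
      show "norm (h n x) \<le> indicator ?K x *\<^sub>R B"
      proof (cases "(\<forall>i. 0 \<le> x $ i) \<and> g0 n x \<in> G (Suc n)")
        case True
        have \<delta>_le: "\<delta> n \<le> t" using t by (simp add: \<delta>_def divide_simps)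
        have le: "\<delta> n * g0 n x i \<le> t" for i
        proof -
          have "real (g0 n x i) \<le> real (Suc n)" using True unfolding G_def of_nat_le_iff by blast
          then have "\<delta> n * g0 n x i \<le> \<delta> n * Suc n" using \<delta>[of n] by (intro mult_left_mono) auto
          also have "\<dots> = t" by (simp add: \<delta>_def)
          finally show ?thesis .
        qed
        have "x \<in> ?K"
          unfolding mem_box_cart
        proof
          fix i show "0 $ i \<le> x $ i \<and> x $ i \<le> (\<chi> i. 2 * t) $ i"
            using le[of i] \<delta>_le floor_bounds(2)[of x i n] True by auto
        qed
        moreover have "(\<chi> i. \<delta> n * g0 n x i) \<in> ?K"
          unfolding mem_box_cart
        proof
          fix i show "0 $ i \<le> (\<chi> i. \<delta> n * g0 n x i) $ i \<and> (\<chi> i. \<delta> n * g0 n x i) $ i \<le> (\<chi> i. 2 * t) $ i"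
            using le[of i] t \<delta>[of n] by auto
        qed
        ultimately show ?thesis using B True by (simp add: h_eq)
      next
        case False
        then have "h n x = 0" by (auto simp: h_eq)
        moreover have "B \<ge> 0" using B[of 0] t by (auto simp: mem_box_cart)
        ultimately show ?thesis by (simp add: indicator_def)
      qed
    qed
    have "AE x in (lborel :: (real, 'n) vec measure). \<forall>i. x $ i \<noteq> 0 \<and> x $ i \<noteq> t"
    proof -
      have "AE x in lborel. x $ i \<noteq> c" for i :: 'n and c :: real
      proof -
        have "closed {x :: (real, 'n) vec. x $ i = c}"
          by (intro closed_Collect_eq continuous_intros)
        moreover have "negligible {x :: (real, 'n) vec. x $ i = c}"
          unfolding cart_eq_inner_axis by (intro negligible_standard_hyperplane) (simp add: axis_in_Basis_iff)
        ultimately have "{x :: (real, 'n) vec. x $ i = c} \<in> null_sets lborel"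
          unfolding negligible_iff_null_sets by (simp add: null_sets_completion_iff borel_closed)
        then show ?thesis using AE_not_in by force
      qed
      then show ?thesis by (simp add: AE_all_countable)
    qed
    then show "AE x in lborel. (\<lambda>n. h n x) \<longlonglongrightarrow> indicator (cbox 0 (\<chi> i. t)) x *\<^sub>R F x"
    proof eventually_elim
      case (elim x)
      consider i where "x $ i < 0" | i where "\<forall>i. 0 \<le> x $ i" "x $ i > t" | "\<forall>i. 0 \<le> x $ i \<and> x $ i \<le> t"
        by (meson not_le)
      then show ?case
      proof cases
        case (1 i)
        then have neg: "\<not> (\<forall>i. 0 \<le> x $ i)" by (metis not_le)
        then have "h n x = 0" for n by (subst h_eq, subst if_not_P) blast+
        moreover have "x \<notin> cbox 0 (\<chi> i. t)" using neg by (auto simp: mem_box_cart)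
        ultimately show ?thesis by simp
      next
        case (2 i)
        \<comment> \<open>From \<open>N\<close> on the mesh is finer than \<open>x $ i - t\<close>,
          so the cell of \<open>x\<close> is no longer among those summed.\<close>
        obtain N :: nat where N: "t / (x $ i - t) < N" using reals_Archimedean2 by blast
        have "h n x = 0" if "n \<ge> N" for n
        proof -
          have "t / (x $ i - t) < Suc n" using N that by linarith
          then have "\<delta> n < x $ i - t" using 2 t by (simp add: \<delta>_def field_simps)
          then have "t < \<delta> n * g0 n x i" using floor_bounds(2)[of x i n] 2 by auto
          also have "t = \<delta> n * Suc n" by (simp add: \<delta>_def)
          finally have "Suc n < g0 n x i" using \<delta>[of n] by (simp del: of_nat_Suc)
          then have "g0 n x \<notin> G (Suc n)" unfolding G_def by (auto simp: not_le)
          then show ?thesis by (simp add: h_eq)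
        qed
        then have "(\<lambda>n. h n x) \<longlonglongrightarrow> 0"
          by (intro tendsto_eventually) (auto simp: eventually_sequentially)
        moreover have "x \<notin> cbox 0 (\<chi> i. t)" using 2(2) unfolding mem_box_cart by (metis not_le vec_lambda_beta)
        ultimately show ?thesis by simp
      next
        case 3
        have inG: "g0 n x \<in> G (Suc n)" for n
        proof -
          have "g0 n x i \<le> Suc n" for i
          proof -
            have "\<delta> n * g0 n x i \<le> \<delta> n * Suc n"
              using floor_bounds(1)[of x i n] 3 by (auto simp: \<delta>_def intro: order_trans)
            then show ?thesis using \<delta>[of n] by (simp del: of_nat_Suc)
          qed
          then show ?thesis by (simp add: G_def)
        qed
        have d0: "\<delta> \<longlonglongrightarrow> 0"
          unfolding \<delta>_def[abs_def] by (intro LIMSEQ_Suc lim_const_over_n)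
        have "(\<lambda>n. \<delta> n * g0 n x i) \<longlonglongrightarrow> x $ i" for i
        proof (rule tendsto_sandwich)
          show "\<forall>\<^sub>F n in sequentially. x $ i - \<delta> n \<le> \<delta> n * g0 n x i"
            "\<forall>\<^sub>F n in sequentially. \<delta> n * g0 n x i \<le> x $ i"
            using floor_bounds[of x i] 3 by auto
          show "(\<lambda>n. x $ i - \<delta> n) \<longlonglongrightarrow> x $ i"
            using tendsto_diff[OF tendsto_const d0, of "x $ i"] by simp
        qed simp
        then have "(\<lambda>n. \<chi> i. \<delta> n * g0 n x i) \<longlonglongrightarrow> (\<chi> i. x $ i)"
          by (intro tendsto_vec_lambda)
        then have "(\<lambda>n. F (\<chi> i. \<delta> n * g0 n x i)) \<longlonglongrightarrow> F x"
          using F by (intro continuous_on_tendsto_compose[OF F]) (auto simp: vec_lambda_eta)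
        moreover have "x \<in> cbox 0 (\<chi> i. t)" using 3 by (auto simp: mem_box_cart)
        ultimately show ?thesis using inG 3 by (simp add: h_eq)
      qed
    qed
  qed
  also have "integral\<^sup>L lborel (\<lambda>x. indicator (cbox 0 (\<chi> i. t)) x *\<^sub>R F x) = integral (cbox 0 (\<chi> i. t)) F"
    using set_borel_integral_eq_integral(2)[of "cbox 0 (\<chi> i. t)" F]
      borel_integrable_compact[of "cbox 0 (\<chi> i. t)" F] continuous_on_subset[OF F]
    by (auto simp: set_integrable_def set_lebesgue_integral_def)
  finally show "(\<lambda>n. (t / real (Suc n)) ^ CARD('n) *
      (\<Sum>g | \<forall>i. g i \<le> Suc n. F (\<chi> i. t / real (Suc n) * real (g i))))
    \<longlonglongrightarrow> integral (cbox 0 (\<chi> i. t)) F"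
    unfolding int_h by (simp only: \<delta>_def G_def)
qed

section \<open>Grid points and increasing tuples\<close>

lemma coord_no_strict_mono: "i < j \<longleftrightarrow> coord_no i < coord_no j" for i j :: "'n::{finite,wellorder}"
  using coord_no_above[of i] coord_no_above[of j] above_strict_antimono[of i j] above_strict_antimono[of j i]
  by (cases i j rule: linorder_cases) auto

lemma coord_no_bij: "bij_betw (coord_no :: 'n::{finite,wellorder} \<Rightarrow> nat) UNIV {1..CARD('n)}"
proof -
  have inj: "inj (coord_no :: 'n \<Rightarrow> nat)"
    by (rule injI) (metis coord_no_strict_mono less_irrefl neqE)
  have "range (coord_no :: 'n \<Rightarrow> nat) \<subseteq> {1..CARD('n)}"
    using coord_no_above[where 'n='n] coord_no_pos[where 'n='n]
    by (auto simp: Suc_le_eq) (metis le_add1)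
  then have "range (coord_no :: 'n \<Rightarrow> nat) = {1..CARD('n)}"
    by (rule card_subset_eq[rotated]) (auto simp: card_image[OF inj])
  then show ?thesis using inj by (simp add: bij_betw_def)
qed

lemma bij_betw_increasing_tuples:
  "bij_betw (\<lambda>f i. f (coord_no i)) (increasing_tuples CARD('n) n)
    {g :: 'n::{finite,wellorder} \<Rightarrow> nat. (\<forall>i. g i \<le> n) \<and> strict_mono g}"
proof -
  let ?c = "coord_no :: 'n \<Rightarrow> nat"
  define c' where "c' = inv_into UNIV ?c"
  have c': "c' (?c i) = i" for i
    unfolding c'_def using coord_no_bij[where 'n='n] by (simp add: bij_betw_def inv_f_f)
  have cc': "?c (c' k) = k" if "k \<in> {1..CARD('n)}" for k
    unfolding c'_def using coord_no_bij[where 'n='n] that by (metis bij_betw_def f_inv_into_f)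
  have cin: "?c i \<in> {1..CARD('n)}" for i
    using coord_no_bij[where 'n='n] by (auto simp: bij_betw_def)
  show ?thesis
  proof (rule bij_betw_byWitness[where f'="\<lambda>g. restrict (\<lambda>k. g (c' k)) {1..CARD('n)}"])
    show "\<forall>f\<in>increasing_tuples CARD('n) n. restrict (\<lambda>k. f (?c (c' k))) {1..CARD('n)} = f"
      unfolding increasing_tuples_def using cc' by (auto simp: fun_eq_iff PiE_def extensional_def restrict_def)
    show "\<forall>g\<in>{g. (\<forall>i. g i \<le> n) \<and> strict_mono g}. (\<lambda>i. restrict (\<lambda>k. g (c' k)) {1..CARD('n)} (?c i)) = g"
      using cin c' by auto
    show "(\<lambda>f i. f (?c i)) ` increasing_tuples CARD('n) n \<subseteq> {g. (\<forall>i. g i \<le> n) \<and> strict_mono g}"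
    proof (intro image_subsetI CollectI conjI allI)
      fix f assume f: "f \<in> increasing_tuples CARD('n) n"
      show "f (?c i) \<le> n" for i
        using f cin[of i] unfolding increasing_tuples_def by (auto simp: PiE_def Pi_def)
      show "strict_mono (\<lambda>i. f (?c i))"
        using f cin unfolding increasing_tuples_def
        by (auto intro!: strict_monoI strict_mono_onD[of "{1..CARD('n)}" f] simp: coord_no_strict_mono)
    qed
    show "(\<lambda>g. restrict (\<lambda>k. g (c' k)) {1..CARD('n)}) ` {g. (\<forall>i. g i \<le> n) \<and> strict_mono g}
        \<subseteq> increasing_tuples CARD('n) n"
    proof (intro image_subsetI)
      fix g :: "'n \<Rightarrow> nat" assume g: "g \<in> {g. (\<forall>i. g i \<le> n) \<and> strict_mono g}"
      have "c' k < c' l" if "k \<in> {1..CARD('n)}" "l \<in> {1..CARD('n)}" "k < l" for k l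
        unfolding coord_no_strict_mono using that by (simp add: cc')
      then show "restrict (\<lambda>k. g (c' k)) {1..CARD('n)} \<in> increasing_tuples CARD('n) n"
        using g unfolding increasing_tuples_def
        by (auto intro!: strict_mono_onI simp: strict_mono_less)
    qed
  qed
qed

lemma prod_pairs_coord_no:
  "(\<Prod>(\<alpha>, \<beta>)\<in>{(\<alpha>, \<beta>). 1 \<le> \<alpha> \<and> \<alpha> < \<beta> \<and> \<beta> \<le> CARD('n)}. f \<alpha> \<beta> :: real) =
    (\<Prod>(i, l)\<in>{(i, l). i < (l :: 'n::{finite,wellorder})}. f (coord_no i) (coord_no l))"
proof -
  have r: "range (coord_no :: 'n \<Rightarrow> nat) = {1..CARD('n)}" and inj: "inj (coord_no :: 'n \<Rightarrow> nat)"
    using coord_no_bij[where 'n='n] by (auto simp: bij_betw_def)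
  have "bij_betw (map_prod coord_no coord_no) {(i, l). i < (l :: 'n)}
      {(\<alpha>, \<beta>). 1 \<le> \<alpha> \<and> \<alpha> < \<beta> \<and> \<beta> \<le> CARD('n)}"
    unfolding bij_betw_def
  proof (intro conjI set_eqI iffI)
    show "inj_on (map_prod coord_no coord_no) {(i, l). i < (l :: 'n)}"
      using prod.inj_map[OF inj inj] by (rule inj_on_subset) simp
    fix p
    { assume "p \<in> map_prod coord_no coord_no ` {(i, l). i < (l :: 'n)}"
      then show "p \<in> {(\<alpha>, \<beta>). 1 \<le> \<alpha> \<and> \<alpha> < \<beta> \<and> \<beta> \<le> CARD('n)}"
        using r by (auto simp: coord_no_strict_mono Suc_le_eq coord_no_pos) }
    { assume p: "p \<in> {(\<alpha>, \<beta>). 1 \<le> \<alpha> \<and> \<alpha> < \<beta> \<and> \<beta> \<le> CARD('n)}"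
      then have "fst p \<in> range (coord_no :: 'n \<Rightarrow> nat)" "snd p \<in> range (coord_no :: 'n \<Rightarrow> nat)"
        unfolding r by auto
      then obtain i l :: 'n where "p = (coord_no i, coord_no l)" by (metis prod.collapse rangeE)
      then show "p \<in> map_prod coord_no coord_no ` {(i, l). i < (l :: 'n)}"
        using p by (auto simp: coord_no_strict_mono intro!: image_eqI[of _ _ "(i, l)"]) }
  qed
  from prod.reindex_bij_betw[OF this, of "\<lambda>(\<alpha>, \<beta>). f \<alpha> \<beta>", symmetric]
  show ?thesis by (simp add: case_prod_beta)
qed

text \<open>Homogeneity: the cell volume gives \<open>CARD('n)\<close> factors \<delta> and each
  pair \<open>i < l\<close> one more. The truncation annihilates every grid point that is not
  strictly increasing, and the others correspond to the tuples of
  \<open>vandermonde_sum\<close>.\<close>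

lemma ordered_vandermonde_grid_sum:
  assumes "\<delta> \<ge> 0"
  shows "\<delta> ^ CARD('n) * (\<Sum>g | \<forall>i. g i \<le> n. ordered_vandermonde (\<chi> i::'n::{finite,wellorder}. \<delta> * real (g i))) =
    \<delta> ^ (CARD('n) * (CARD('n) + 1) div 2) * vandermonde_sum CARD('n) n"
proof -
  let ?P = "{(i, l). i < (l :: 'n)}"
  have card: "CARD('n) + card ?P = CARD('n) * (CARD('n) + 1) div 2"
  proof -
    have "CARD('n) + (\<Sum>e<CARD('n). e) = (\<Sum>e\<le>CARD('n). e)"
      by (simp add: lessThan_Suc_atMost[symmetric])
    then show ?thesis
      unfolding card_greater_pairs_sum using gauss_sum_nat[of "CARD('n)"] by (simp add: atMost_atLeast0)
  qed
  have eq: "ordered_vandermonde (\<chi> i::'n. \<delta> * real (g i)) =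
      \<delta> ^ card ?P * (\<Prod>(i, l)\<in>?P. max 0 (real (g l) - real (g i)))" for g
  proof -
    have "ordered_vandermonde (\<chi> i::'n. \<delta> * real (g i)) =
        (\<Prod>p\<in>?P. \<delta> * (case p of (i, l) \<Rightarrow> max 0 (real (g l) - real (g i))))"
      unfolding ordered_vandermonde_def using assms
      by (intro prod.cong) (auto simp: max_def algebra_simps mult_le_cancel_left)
    then show ?thesis by (simp only: prod.distrib prod_constant)
  qed
  have "(\<Sum>g | \<forall>i. g i \<le> n. \<Prod>(i, l)\<in>?P. max 0 (real (g l) - real (g i))) =
      (\<Sum>g | (\<forall>i. g i \<le> n) \<and> strict_mono g. \<Prod>(i, l)\<in>?P. real (g l) - real (g i))"
  proof (rule sum.mono_neutral_cong_right)
    show "\<forall>g\<in>{g. \<forall>i. g i \<le> n} - {g. (\<forall>i. g i \<le> n) \<and> strict_mono g}.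
        (\<Prod>(i, l)\<in>?P. max 0 (real (g l) - real (g i))) = 0"
    proof
      fix g assume "g \<in> {g :: 'n \<Rightarrow> nat. \<forall>i. g i \<le> n} - {g. (\<forall>i. g i \<le> n) \<and> strict_mono g}"
      then obtain i l where "i < l" "g l \<le> g i" by (auto simp: strict_mono_def not_less)
      then have "\<exists>p\<in>?P. (case p of (i, l) \<Rightarrow> max 0 (real (g l) - real (g i))) = 0"
        by (intro bexI[of _ "(i, l)"]) auto
      then show "(\<Prod>(i, l)\<in>?P. max 0 (real (g l) - real (g i))) = 0"
        by (intro prod_zero) auto
    qed
    show "(\<Prod>(i, l)\<in>?P. max 0 (real (g l) - real (g i))) = (\<Prod>(i, l)\<in>?P. real (g l) - real (g i))"
      if "g \<in> {g. (\<forall>i. g i \<le> n) \<and> strict_mono g}" for g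
    proof (rule prod.cong)
      fix p assume "p \<in> ?P"
      then have "g (fst p) < g (snd p)" using that by (auto simp: strict_mono_def)
      then show "(case p of (i, l) \<Rightarrow> max 0 (real (g l) - real (g i))) = (case p of (i, l) \<Rightarrow> real (g l) - real (g i))"
        by (simp add: case_prod_beta)
    qed simp
  qed (auto simp: finite_bounded_functions)
  also have "\<dots> = (\<Sum>f\<in>increasing_tuples CARD('n) n. \<Prod>(i, l)\<in>?P. real (f (coord_no l)) - real (f (coord_no i)))"
    by (rule sum.reindex_bij_betw[OF bij_betw_increasing_tuples, symmetric])
  also have "\<dots> = vandermonde_sum CARD('n) n"
    unfolding vandermonde_sum_def prod_pairs_coord_no ..
  finally show ?thesis
    unfolding eq sum_distrib_left[symmetric] card[symmetric] by (simp add: power_add)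
qed

text \<open>Since \<open>measure\<close> and \<open>lim\<close> are total functions, measurability
  and convergence are asserted together with the formula. The division by 2 is exact, and the
  default value of the quotient at \<open>n = 0\<close> does not affect the limit.\<close>

theorem theorem1:
  fixes x0 :: "real ^ 'n::{finite,wellorder}" and \<mu> t :: real and d :: nat
  defines "d \<equiv> CARD('n)"
  assumes "d \<ge> 2" and "\<mu> > 0" and "t > 0"
  shows "reach_set \<mu> {x0} t \<in> lmeasurable \<and>
    convergent (\<lambda>n. 1 / real n ^ (d * (d + 1) div 2) * vandermonde_sum d n) \<and>
    measure lebesgue (reach_set \<mu> {x0} t) =
      (2 * \<mu>) ^ d * t ^ (d * (d + 1) div 2) / (\<Prod>k=1..d-1. fact k) *
      lim (\<lambda>n. 1 / real n ^ (d * (d + 1) div 2) * vandermonde_sum d n)"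
proof -
  let ?M = "reach_kernel_set \<mu> t :: (real, 'n) vec set"
  let ?I = "integral (cbox 0 (\<chi> i. t)) (ordered_vandermonde :: (real, 'n) vec \<Rightarrow> real)"
  define D where "D = d * (d + 1) div 2"
  obtain y where y: "reach_set \<mu> {x0} t = (+) y ` ?M"
    using reach_set_eq_translation[of t \<mu> x0] \<open>t > 0\<close> unfolding reach_kernel_set_def
    by (metis less_imp_le)
  have "?M \<in> lmeasurable"
    by (intro measurable_convex convex_reach_kernel_set bounded_reach_kernel_set)
  then have meas: "reach_set \<mu> {x0} t \<in> lmeasurable"
    unfolding y by (rule measurable_translation)
  have vol: "measure lebesgue (reach_set \<mu> {x0} t) = (2 * \<mu>) ^ d / (\<Prod>k=1..d-1. fact k) * ?I"
    unfolding y measure_translation d_def using assms by (intro measure_reach_kernel_set) auto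
  have "(t / real n) ^ d * (\<Sum>g | \<forall>i. g i \<le> n. ordered_vandermonde (\<chi> i::'n. t / real n * real (g i))) =
      (t / real n) ^ D * vandermonde_sum d n" for n
    unfolding d_def D_def using \<open>t > 0\<close> by (intro ordered_vandermonde_grid_sum) auto
  moreover have "(\<lambda>n. (t / real n) ^ d *
      (\<Sum>g | \<forall>i. g i \<le> n. ordered_vandermonde (\<chi> i::'n. t / real n * real (g i)))) \<longlonglongrightarrow> ?I"
    unfolding d_def by (rule riemann_sum_cube[OF continuous_on_ordered_vandermonde \<open>t > 0\<close>])
  ultimately have "(\<lambda>n. (t / real n) ^ D * vandermonde_sum d n) \<longlonglongrightarrow> ?I"
    by (simp only:)
  \<comment> \<open>Removing the power of \<open>t\<close> from the mesh leaves the limit in the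
    theorem; it reappears as the factor in front of \<open>lim\<close>.\<close>
  from tendsto_mult_left[OF this, of "1 / t ^ D"]
  have lim: "(\<lambda>n. 1 / real n ^ D * vandermonde_sum d n) \<longlonglongrightarrow> ?I / t ^ D"
    using \<open>t > 0\<close> by (simp add: power_divide)
  then have "lim (\<lambda>n. 1 / real n ^ D * vandermonde_sum d n) = ?I / t ^ D"
    by (rule limI)
  then show ?thesis
    using meas vol lim \<open>t > 0\<close> unfolding D_def[symmetric] by (auto intro: convergentI)
qed

end
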